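(* Let $2\le n\le p<\infty$ ($n$ an integer), let $\mathcal{A}:\mathbf{R}^n\times\mathbf{R}^n\to\mathbf{R}^n$ satisfy the assumptions (A1)--(A3) of the context with weight $1$, let $w(\xi)=|\xi|^{2(p-n)}$, and let $\Omega\subset\mathbf{R}^n\setminus\{0\}$ be an unbounded open set. Let $T(x)=x/|x|^2$ and let $\mathcal{B}$ be the transformed map defined in the context. Then a function $u$ is $\mathcal{A}$-harmonic in $\Omega$ (weight $1$) if and only if $u\circ T$ is $\mathcal{B}$-harmonic in $T(\Omega)$ (weight $w$). Likewise, a function $u$ is $\mathcal{A}$-superharmonic in $\Omega$ if and only if $u\circ T$ is $\mathcal{B}$-superharmonic in $T(\Omega)$.
   Context: $T:\mathbf{R}^n\setminus\{0\}\to\mathbf{R}^n\setminus\{0\}$ is $T(x)=x/|x|^2$, $dT(x)$ is its Jacobian matrix at $x$ and $J_T(x)$ the determinant of $dT(x)$. The map $\mathcal{B}:\mathbf{R}^n\times\mathbf{R}^n\to\mathbf{R}^n$ is $\mathcal{B}(\xi,q)=|J_T(x)|^{-1}dT(x)\mathcal{A}(x,dT(x)q)$ with $x=T(\xi)$ if $\xi\ne0$, and $\mathcal{B}(0,q)=0$. Conditions for a map $\mathcal{C}:\mathbf{R}^n\times\mathbf{R}^n\to\mathbf{R}^n$ with weight $\omega$: (A1) $\mathcal{C}(\cdot,q)$ is measurable for all $q$. (A2) $\mathcal{C}(x,\cdot)$ is continuous for a.e. $x$. (A3) There are $\alpha_2\ge\alpha_1>0$ such that for a.e. $x$, all $\lambda\in\mathbf{R}\setminus\{0\}$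 and all $q\ne q'$ in $\mathbf{R}^n$: $\mathcal{C}(x,q)\cdot q\ge\alpha_1\omega(x)|q|^p$; $|\mathcal{C}(x,q)|\le\alpha_2\omega(x)|q|^{p-1}$; $\mathcal{C}(x,\lambda q)=\lambda|\lambda|^{p-2}\mathcal{C}(x,q)$; $(\mathcal{C}(x,q)-\mathcal{C}(x,q'))\cdot(q-q')>0$. The map $\mathcal{B}$ satisfies these with weight $w$. In the following, $(\mathcal{C},\omega,V)$ is either $(\mathcal{A},1,\Omega)$ or $(\mathcal{B},w,T(\Omega))$. $G\Subset V$ means $\overline{G}$ is a compact subset of $V$; $C_0^\infty(V)=\{u\in C^\infty(\mathbf{R}^n):\operatorname{supp}u\Subset V\}$. $H^{1,p}(V,\omega)$ consists of the $u\in L^p(V,\omega)$ (the $L^p$-space for $\omega\,dx$) for which there are $v\in L^p(V,\omega)$ and $\varphi_j\in C^\infty(V)$ with $\varphi_j\to u$ and $\nabla\varphi_j\to v$ in $L^p(V,\omega)$; $v$ is unique and denoted $\nabla u$. $H^{1,p}_{\mathrm{loc}}(V,\omega)$ consists of the $u\in L^p_{\mathrm{loc}}(V,\omega)$ with $u|_G\in H^{1,p}(G,\omega)$ for every open $G\Subset V$. A function $u\in H^{1,p}_{\mathrm{loc}}(V,\omega)\cap C(V)$ is $\mathcal{C}$-harmonic in $V$ if $\int_V\mathcal{C}(x,\nabla u)\cdot\nabla\varphi\,dx=0$ for all $\varphi\in C_0^\infty(V)$. A function $u:V\to(-\infty,\infty]$ is $\mathcal{C}$-superharmonic if it is lower semicontinuous,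 $u\not\equiv\infty$ in each component of $V$, and for each open $G\Subset V$ and all $v\in C(\overline{G})$ that are $\mathcal{C}$-harmonic in $G$, $v\le u$ on $\partial G$ implies $v\le u$ in $G$. *)

theory Defs
  imports "HOL-Analysis.Analysis"
begin

text \<open>
  Functions on a set \<open>V\<close> are total functions of which only the values on \<open>V\<close> matter, and elements
  of \<open>L\<^sup>p\<close> are functions rather than classes modulo equality almost everywhere; all notions below
  are invariant under changes on null sets where this is relevant.
\<close>

definition compactly_inside :: "'a::topological_space set \<Rightarrow> 'a set \<Rightarrow> bool"
  where "compactly_inside G V \<longleftrightarrow> compact (closure G) \<and> closure G \<subseteq> V"

primrec Ck_on :: "nat \<Rightarrow> 'a::euclidean_space set \<Rightarrow> ('a \<Rightarrow> real) \<Rightarrow> bool"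
  where
    "Ck_on 0 V f \<longleftrightarrow> continuous_on V f"
  | "Ck_on (Suc k) V f \<longleftrightarrow>
       (\<forall>x\<in>V. f differentiable (at x)) \<and>
       (\<forall>h. Ck_on k V (\<lambda>x. frechet_derivative f (at x) h))"

text \<open>\<open>C\<^sup>\<infinity>(V)\<close>; the derivatives are taken at full neighbourhoods, so \<open>V\<close> is meant to be open.\<close>

definition smooth_on :: "'a::euclidean_space set \<Rightarrow> ('a \<Rightarrow> real) \<Rightarrow> bool"
  where "smooth_on V f \<longleftrightarrow> (\<forall>k. Ck_on k V f)"

definition test_function :: "'a::euclidean_space set \<Rightarrow> ('a \<Rightarrow> real) \<Rightarrow> bool"
  where "test_function V f \<longleftrightarrow> smooth_on UNIV f \<and> compactly_inside {x. f x \<noteq> 0} V"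

definition grad :: "('a::real_inner \<Rightarrow> real) \<Rightarrow> 'a \<Rightarrow> 'a"
  where "grad f x = (THE D. GDERIV f x :> D)"

definition weighted_on :: "('a::euclidean_space \<Rightarrow> real) \<Rightarrow> 'a set \<Rightarrow> 'a measure"
  where "weighted_on \<omega> V = density (lebesgue_on V) (\<lambda>x. ennreal (\<omega> x))"

definition Lp :: "real \<Rightarrow> ('a::euclidean_space \<Rightarrow> real) \<Rightarrow> 'a set \<Rightarrow> ('a \<Rightarrow> 'b::euclidean_space) \<Rightarrow> bool"
  where "Lp p \<omega> V f \<longleftrightarrow>
    f \<in> borel_measurable (weighted_on \<omega> V) \<and>
    integrable (weighted_on \<omega> V) (\<lambda>x. norm (f x) powr p)"

definition Lp_loc :: "real \<Rightarrow> ('a::euclidean_space \<Rightarrow> real) \<Rightarrow> 'a set \<Rightarrow> ('a \<Rightarrow> 'b::euclidean_space) \<Rightarrow> bool"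
  where "Lp_loc p \<omega> V f \<longleftrightarrow> (\<forall>G. open G \<longrightarrow> compactly_inside G V \<longrightarrow> Lp p \<omega> G f)"

text \<open>
  The distance is measured by the nonnegative integral: the Bochner integral of a non-integrable
  function is \<open>0\<close>.
\<close>

definition Lp_converges ::
  "real \<Rightarrow> ('a::euclidean_space \<Rightarrow> real) \<Rightarrow> 'a set \<Rightarrow> (nat \<Rightarrow> 'a \<Rightarrow> 'b::euclidean_space) \<Rightarrow> ('a \<Rightarrow> 'b) \<Rightarrow> bool"
  where "Lp_converges p \<omega> V \<phi> f \<longleftrightarrow>
    (\<forall>j. Lp p \<omega> V (\<phi> j)) \<and> Lp p \<omega> V f \<and>
    (\<lambda>j. \<integral>\<^sup>+x. ennreal (norm (\<phi> j x - f x) powr p) \<partial>weighted_on \<omega> V) \<longlonglongrightarrow> 0"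

text \<open>\<open>v\<close> is (a representative of) the gradient \<open>\<nabla>u\<close> of \<open>u \<in> H\<^sup>1\<^sup>,\<^sup>p(V, \<omega>)\<close>.\<close>

definition has_H1p_gradient ::
  "real \<Rightarrow> ('a::euclidean_space \<Rightarrow> real) \<Rightarrow> 'a set \<Rightarrow> ('a \<Rightarrow> real) \<Rightarrow> ('a \<Rightarrow> 'a) \<Rightarrow> bool"
  where "has_H1p_gradient p \<omega> V u v \<longleftrightarrow>
    Lp p \<omega> V u \<and> Lp p \<omega> V v \<and>
    (\<exists>\<phi>. (\<forall>j. smooth_on V (\<phi> j)) \<and>
         Lp_converges p \<omega> V \<phi> u \<and> Lp_converges p \<omega> V (\<lambda>j. grad (\<phi> j)) v)"

definition H1p :: "real \<Rightarrow> ('a::euclidean_space \<Rightarrow> real) \<Rightarrow> 'a set \<Rightarrow> ('a \<Rightarrow> real) \<Rightarrow> bool"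
  where "H1p p \<omega> V u \<longleftrightarrow> (\<exists>v. has_H1p_gradient p \<omega> V u v)"

definition H1p_loc :: "real \<Rightarrow> ('a::euclidean_space \<Rightarrow> real) \<Rightarrow> 'a set \<Rightarrow> ('a \<Rightarrow> real) \<Rightarrow> bool"
  where "H1p_loc p \<omega> V u \<longleftrightarrow>
    Lp_loc p \<omega> V u \<and> (\<forall>G. open G \<longrightarrow> compactly_inside G V \<longrightarrow> H1p p \<omega> G u)"

definition has_H1p_loc_gradient ::
  "real \<Rightarrow> ('a::euclidean_space \<Rightarrow> real) \<Rightarrow> 'a set \<Rightarrow> ('a \<Rightarrow> real) \<Rightarrow> ('a \<Rightarrow> 'a) \<Rightarrow> bool"
  where "has_H1p_loc_gradient p \<omega> V u v \<longleftrightarrow>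
    (\<forall>G. open G \<longrightarrow> compactly_inside G V \<longrightarrow> has_H1p_gradient p \<omega> G u v)"

definition cond_A1 :: "('a::euclidean_space \<Rightarrow> 'a \<Rightarrow> 'a) \<Rightarrow> bool"
  where "cond_A1 C \<longleftrightarrow> (\<forall>q. (\<lambda>x. C x q) \<in> borel_measurable lebesgue)"

definition cond_A2 :: "('a::euclidean_space \<Rightarrow> 'a \<Rightarrow> 'a) \<Rightarrow> bool"
  where "cond_A2 C \<longleftrightarrow> (AE x in lebesgue. continuous_on UNIV (C x))"

definition cond_A3 :: "real \<Rightarrow> ('a::euclidean_space \<Rightarrow> real) \<Rightarrow> ('a \<Rightarrow> 'a \<Rightarrow> 'a) \<Rightarrow> bool"
  where "cond_A3 p \<omega> C \<longleftrightarrow>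
    (\<exists>\<alpha>1 \<alpha>2. 0 < \<alpha>1 \<and> \<alpha>1 \<le> \<alpha>2 \<and>
      (AE x in lebesgue. \<forall>l q q'. l \<noteq> 0 \<longrightarrow> q \<noteq> q' \<longrightarrow>
         C x q \<bullet> q \<ge> \<alpha>1 * \<omega> x * norm q powr p \<and>
         norm (C x q) \<le> \<alpha>2 * \<omega> x * norm q powr (p - 1) \<and>
         C x (l *\<^sub>R q) = (l * \<bar>l\<bar> powr (p - 2)) *\<^sub>R C x q \<and>
         (C x q - C x q') \<bullet> (q - q') > 0))"

text \<open>
  The gradient of a function in \<open>H\<^sup>1\<^sup>,\<^sup>p\<^sub>l\<^sub>o\<^sub>c\<close> is unique almost everywhere in \<open>V\<close>, so that it does not
  matter which representative \<open>v\<close> is used.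
\<close>

definition harmonic_in ::
  "real \<Rightarrow> ('a::euclidean_space \<Rightarrow> 'a \<Rightarrow> 'a) \<Rightarrow> ('a \<Rightarrow> real) \<Rightarrow> 'a set \<Rightarrow> ('a \<Rightarrow> real) \<Rightarrow> bool"
  where "harmonic_in p C \<omega> V u \<longleftrightarrow>
    H1p_loc p \<omega> V u \<and> continuous_on V u \<and>
    (\<exists>v. has_H1p_loc_gradient p \<omega> V u v \<and>
      (\<forall>\<phi>. test_function V \<phi> \<longrightarrow> (LINT x:V|lebesgue. C x (v x) \<bullet> grad \<phi> x) = 0))"

definition lower_semicontinuous_on :: "'a::topological_space set \<Rightarrow> ('a \<Rightarrow> ereal) \<Rightarrow> bool"
  where "lower_semicontinuous_on V u \<longleftrightarrow> (\<forall>t. openin (top_of_set V) {x\<in>V. t < u x})"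

definition superharmonic_in ::
  "real \<Rightarrow> ('a::euclidean_space \<Rightarrow> 'a \<Rightarrow> 'a) \<Rightarrow> ('a \<Rightarrow> real) \<Rightarrow> 'a set \<Rightarrow> ('a \<Rightarrow> ereal) \<Rightarrow> bool"
  where "superharmonic_in p C \<omega> V u \<longleftrightarrow>
    (\<forall>x\<in>V. u x \<noteq> -\<infinity>) \<and>
    lower_semicontinuous_on V u \<and>
    (\<forall>K\<in>components V. \<exists>x\<in>K. u x \<noteq> \<infinity>) \<and>
    (\<forall>G v. open G \<longrightarrow> compactly_inside G V \<longrightarrow>
       continuous_on (closure G) v \<longrightarrow> harmonic_in p C \<omega> G v \<longrightarrow>
       (\<forall>x\<in>frontier G. ereal (v x) \<le> u x) \<longrightarrow> (\<forall>x\<in>G. ereal (v x) \<le> u x))"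

text \<open>Here \<open>inversion 0 = 0\<close>; this value is irrelevant.\<close>

definition inversion :: "real^'n \<Rightarrow> real^'n"
  where "inversion x = x /\<^sub>R (norm x)\<^sup>2"

definition transformed_map ::
  "(real^'n \<Rightarrow> real^'n \<Rightarrow> real^'n) \<Rightarrow> real^'n \<Rightarrow> real^'n \<Rightarrow> real^'n"
  where "transformed_map A \<xi> q =
    (if \<xi> = 0 then 0
     else let x = inversion \<xi>; dT = jacobian inversion (at x)
          in inverse \<bar>det dT\<bar> *\<^sub>R (dT *v A x (dT *v q)))"

text \<open>
  For \<open>p = n\<close> the value at \<open>0\<close> is \<open>0 powr 0 = 0\<close> instead of \<open>1\<close>; a weight only matters almost
  everywhere.
\<close>

definition inversion_weight :: "real \<Rightarrow> real^'n \<Rightarrow> real"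
  where "inversion_weight p \<xi> = norm \<xi> powr (2 * (p - real CARD('n)))"

end

theory Submission
  imports Defs
begin

text \<open>
  The inversion \<open>T\<close> is a smooth involution of the punctured space. Its differential \<open>dT(\<xi>)\<close> is
  \<open>|\<xi>|\<^sup>-\<^sup>2\<close> times a reflection; hence it is selfadjoint, inverse to \<open>dT(T\<xi>)\<close>, and its determinant
  has modulus \<open>|\<xi>|\<close> to the power \<open>-2n\<close>. If \<open>u\<close> has the gradient \<open>v\<close>, the chain rule suggests the
  gradient \<open>\<xi> \<mapsto> dT(\<xi>) v(T\<xi>)\<close> for \<open>u \<circ> T\<close>, and inserting it into the transformed map gives, for
  test functions \<open>\<phi> = \<psi> \<circ> T\<close>,
  \<open>\<B>(\<xi>, dT(\<xi>) v(T\<xi>)) \<bullet> \<nabla>\<phi>(\<xi>) = |J\<^sub>T(\<xi>)| (\<A>(T\<xi>, v(T\<xi>)) \<bullet> \<nabla>\<psi>(T\<xi>))\<close>.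
  By change of variables the two weak equations are the same equation, since \<open>\<psi> \<mapsto> \<psi> \<circ> T\<close> is a
  bijection between the test functions on \<open>\<Omega>\<close> and on \<open>T(\<Omega>)\<close>. This is
  \<open>harmonic_in_inversion\<close>.

  The Sobolev part of the statement is local: only open sets \<open>G\<close> with compact closure in the
  punctured space enter. On such a set \<open>|J\<^sub>T|\<close>, the operator norm of \<open>dT\<close> and the weights lie
  between positive constants, so composition with \<open>T\<close> maps a convergent sequence of smooth
  functions with convergent gradients to another one (\<open>has_H1p_gradient_inversion\<close>). The weights \<open>1\<close>
  and \<open>w\<close> enter only through these bounds, so any two weights that are positive and continuous
  off the origin may be exchanged.

  Transforming the map \<open>\<A>\<close> twice gives back \<open>\<A>\<close>, and \<open>T\<close> is its own inverse. Therefore each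
  equivalence follows from one implication, applied once to \<open>(\<A>, \<Omega>)\<close> and once to \<open>(\<B>, T(\<Omega>))\<close>.
  For superharmonic functions the comparison functions on \<open>G\<close> are pulled back to \<open>T(G)\<close> by the
  result for harmonic functions; the other conditions are topological, and \<open>T\<close> is a homeomorphism.
\<close>

section \<open>The differential of the inversion\<close>

lemma inversion_0 [simp]: "inversion 0 = 0"
  by (simp add: inversion_def)

lemma inversion_eq_0_iff [simp]: "inversion x = 0 \<longleftrightarrow> x = 0"
  by (simp add: inversion_def)

lemma norm_inversion: "norm (inversion x) = inverse (norm x)"
  by (cases "x = 0") (simp_all add: inversion_def power2_eq_square field_simps)

lemma inversion_inversion [simp]: "inversion (inversion x) = x"
proof (cases "x = 0")
  case False
  then show ?thesis
    by (simp add: inversion_def power2_eq_square field_simps)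
qed simp

lemma inversion_comp_inversion [simp]: "inversion \<circ> inversion = id"
  by (simp add: fun_eq_iff)

lemma inj_inversion: "inj_on inversion S"
  by (metis inj_on_inverseI inversion_inversion)

lemma inversion_image_eq_vimage: "inversion ` S = inversion -` S"
  by (auto simp: image_iff) (metis inversion_inversion)

lemma inversion_image_inversion_image [simp]: "inversion ` inversion ` S = S"
  by (simp add: image_image)

text \<open>
  The differential \<open>dT(x)\<close>: a reflection in the hyperplane orthogonal to \<open>x\<close>, scaled by \<open>|x|\<^sup>-\<^sup>2\<close>.
\<close>
definition inversion_deriv :: "real^'n \<Rightarrow> real^'n \<Rightarrow> real^'n"
  where "inversion_deriv x h = (h - (2 * (x \<bullet> h) / (norm x)\<^sup>2) *\<^sub>R x) /\<^sub>R (norm x)\<^sup>2"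

lemma linear_inversion_deriv: "linear (inversion_deriv x)"
  by (rule linearI) (simp_all add: inversion_deriv_def algebra_simps add_divide_distrib)

lemma has_derivative_inversion:
  fixes x :: "real^'n"
  assumes "x \<noteq> 0"
  shows "(inversion has_derivative inversion_deriv x) (at x within S)"
proof -
  have "((\<lambda>x. inverse (x \<bullet> x) *\<^sub>R x) has_derivative
      (\<lambda>h. inverse (x \<bullet> x) *\<^sub>R h + (- (inverse (x \<bullet> x) * (x \<bullet> h + h \<bullet> x) * inverse (x \<bullet> x))) *\<^sub>R x))
      (at x within S)"
  proof (intro has_derivative_scaleR has_derivative_ident)
    have "((\<lambda>x. x \<bullet> x) has_derivative (\<lambda>h. x \<bullet> h + h \<bullet> x)) (at x within S)"
      by (intro has_derivative_inner has_derivative_ident)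
    from Deriv.has_derivative_inverse[OF _ this] assms
    show "((\<lambda>x. inverse (x \<bullet> x)) has_derivative
        (\<lambda>h. - (inverse (x \<bullet> x) * (x \<bullet> h + h \<bullet> x) * inverse (x \<bullet> x)))) (at x within S)"
      by simp
  qed
  moreover have "(\<lambda>h. inverse (x \<bullet> x) *\<^sub>R h + (- (inverse (x \<bullet> x) * (x \<bullet> h + h \<bullet> x) * inverse (x \<bullet> x))) *\<^sub>R x)
      = inversion_deriv x"
    by (simp add: fun_eq_iff inversion_deriv_def power2_norm_eq_inner inner_commute
        scaleR_diff_right divide_inverse mult_ac)
  moreover have "inversion = (\<lambda>x::real^'n. inverse (x \<bullet> x) *\<^sub>R x)"
    by (simp add: fun_eq_iff inversion_def power2_norm_eq_inner)
  ultimately show ?thesis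
    by simp
qed

lemma continuous_on_inversion: "0 \<notin> S \<Longrightarrow> continuous_on S inversion"
  by (metis continuous_on_eq_continuous_within has_derivative_continuous has_derivative_inversion)

lemma inversion_deriv_selfadjoint: "inversion_deriv x h \<bullet> k = h \<bullet> inversion_deriv x k"
  by (simp add: inversion_deriv_def algebra_simps inner_commute)

lemma norm_inversion_deriv: "norm (inversion_deriv x h) = norm h / (norm x)\<^sup>2"
proof (cases "x = 0")
  case False
  have "(norm (h - (2 * (x \<bullet> h) / (norm x)\<^sup>2) *\<^sub>R x))\<^sup>2 = (norm h)\<^sup>2"
    unfolding power2_norm_eq_inner using False
    by (simp add: algebra_simps inner_commute power2_eq_square)
  then show ?thesis
    by (simp add: inversion_deriv_def divide_inverse mult.commute)
qed (simp add: inversion_deriv_def)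

text \<open>The chain rule for \<open>T \<circ> T = id\<close>, verified from the formula.\<close>
lemma inversion_deriv_inversion:
  assumes "x \<noteq> 0"
  shows "inversion_deriv (inversion x) (inversion_deriv x h) = h"
proof -
  define r where "r = x \<bullet> x"
  have r: "r \<noteq> 0" using assms by (simp add: r_def)
  have n: "(norm x)\<^sup>2 = r" "(norm (inversion x))\<^sup>2 = inverse r"
    by (simp_all add: r_def power2_norm_eq_inner norm_inversion power_inverse)
  have i: "inversion x = x /\<^sub>R r" by (simp add: inversion_def n)
  have xx: "x \<bullet> x = r" by (simp add: r_def)
  have D: "inversion_deriv x h = (1/r) *\<^sub>R h - (2 * (x \<bullet> h) / r\<^sup>2) *\<^sub>R x"
    unfolding inversion_deriv_def n
    by (simp add: scaleR_diff_right power2_eq_square divide_inverse mult_ac)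
  have E: "inversion_deriv (inversion x) k = r *\<^sub>R k - (2 * (x \<bullet> k)) *\<^sub>R x" for k
    unfolding inversion_deriv_def n(2) unfolding i
    using r by (simp add: scaleR_diff_right)
  show ?thesis
    unfolding E unfolding D
    using r by (simp add: algebra_simps xx power2_eq_square)
qed

text \<open>
  The modulus of the Jacobian determinant of the inversion; the value at the origin is \<open>0\<close>, because
  \<open>inverse 0 = 0\<close>.
\<close>
definition inversion_jacobian :: "real^'n \<Rightarrow> real"
  where "inversion_jacobian x = inverse (norm x ^ (2 * CARD('n)))"

lemma abs_det_inversion_deriv:
  fixes x :: "real^'n"
  assumes "x \<noteq> 0"
  shows "\<bar>det (matrix (inversion_deriv x))\<bar> = inversion_jacobian x"
proof -
  define Q where "Q h = (norm x)\<^sup>2 *\<^sub>R inversion_deriv x h" for h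
  (* |x|^2 dT(x) is the unscaled reflection, hence orthogonal. *)
  have "linear Q"
    unfolding Q_def by (intro linear_compose_scale_right linear_inversion_deriv)
  moreover have "norm (Q h) = norm h" for h
    using assms by (simp add: Q_def norm_inversion_deriv)
  ultimately have "orthogonal_transformation Q"
    by (simp add: orthogonal_transformation)
  then have Q: "\<bar>det (matrix Q)\<bar> = 1"
    using orthogonal_transformation_det by blast
  have "inversion_deriv x = (*\<^sub>R) (inverse ((norm x)\<^sup>2)) \<circ> Q"
    using assms by (simp add: fun_eq_iff Q_def)
  then have "matrix (inversion_deriv x) = matrix ((*\<^sub>R) (inverse ((norm x)\<^sup>2))) ** matrix Q"
    using \<open>linear Q\<close> by (simp add: matrix_compose)
  then show ?thesis
    using Q by (simp add: det_mul abs_mult inversion_jacobian_def power_inverse power_mult power_abs)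
qed

lemma inversion_jacobian_nonneg [simp]: "0 \<le> inversion_jacobian x"
  by (simp add: inversion_jacobian_def)

lemma inversion_jacobian_0 [simp]: "inversion_jacobian 0 = 0"
  by (simp add: inversion_jacobian_def)

lemma inversion_jacobian_inversion:
  "inversion_jacobian (inversion x) = inverse (inversion_jacobian x)"
  by (simp add: inversion_jacobian_def norm_inversion power_inverse)

lemma inversion_jacobian_pos: "x \<noteq> 0 \<Longrightarrow> 0 < inversion_jacobian x"
  by (simp add: inversion_jacobian_def)

lemma inversion_jacobian_mult_inversion:
  "x \<noteq> 0 \<Longrightarrow> inversion_jacobian x * inversion_jacobian (inversion x) = 1"
  using inversion_jacobian_pos[of x] by (simp add: inversion_jacobian_inversion)

lemma open_inversion_image:
  assumes "open V" "0 \<notin> V"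
  shows "open (inversion ` V)"
proof -
  have "open (- {0} \<inter> inversion -` V)"
    using assms by (intro continuous_open_preimage continuous_on_inversion) auto
  moreover have "- {0} \<inter> inversion -` V = inversion ` V"
    unfolding inversion_image_eq_vimage using assms(2) by auto
  ultimately show ?thesis by simp
qed

section \<open>Bounded regions away from the origin\<close>

text \<open>
  The open sets on which the Sobolev estimates are carried out: compactness of the closure inside
  the punctured space keeps all the weights and the Jacobian between positive constants.
\<close>
definition off_origin :: "'a::euclidean_space set \<Rightarrow> bool"
  where "off_origin V \<longleftrightarrow> open V \<and> compactly_inside V (- {0})"

lemma off_origin_if_compactly_inside:
  "open G \<Longrightarrow> compactly_inside G V \<Longrightarrow> 0 \<notin> V \<Longrightarrow> off_origin G"
  by (auto simp: off_origin_def compactly_inside_def)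

text \<open>
  One inclusion holds as the image of the compact closure is closed. Applied to the image of \<open>S\<close>,
  which again lies compactly inside the punctured space, it gives the other inclusion, by
  involutivity.
\<close>
lemma closure_inversion_image:
  assumes "compactly_inside S (- {0})"
  shows "closure (inversion ` S) = inversion ` closure S"
proof -
  have half: "closure (inversion ` T) \<subseteq> inversion ` closure T" "compact (inversion ` closure T)"
    if "compactly_inside T (- {0})" for T :: "(real^'n) set"
  proof -
    show "compact (inversion ` closure T)"
      using that by (intro compact_continuous_image continuous_on_inversion) (auto simp: compactly_inside_def)
    then show "closure (inversion ` T) \<subseteq> inversion ` closure T"
      by (intro closure_minimal image_mono closure_subset compact_imp_closed)
  qed
  have "closure (inversion ` S) \<subseteq> inversion ` closure S"
    by (rule half[OF assms])
  moreover have "0 \<notin> inversion ` closure S"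
    using assms by (auto simp: compactly_inside_def dest: sym)
  ultimately have "compactly_inside (inversion ` S) (- {0})"
    using half(2)[OF assms] unfolding compactly_inside_def
    by (meson bounded_subset closed_closure compact_eq_bounded_closed subset_Compl_singleton subset_iff)
  from half(1)[OF this] have "closure S \<subseteq> inversion ` closure (inversion ` S)"
    by simp
  then have "inversion ` closure S \<subseteq> inversion ` inversion ` closure (inversion ` S)"
    by (rule image_mono)
  with half(1)[OF assms] show ?thesis
    by simp
qed

lemma compactly_inside_inversion:
  assumes "compactly_inside S V" "0 \<notin> V"
  shows "compactly_inside (inversion ` S) (inversion ` V)"
proof -
  have S: "compactly_inside S (- {0})"
    using assms by (auto simp: compactly_inside_def)
  moreover have "compact (inversion ` closure S)"
    using S by (intro compact_continuous_image continuous_on_inversion) (auto simp: compactly_inside_def)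
  ultimately show ?thesis
    using assms(1) by (auto simp: compactly_inside_def closure_inversion_image)
qed

lemma frontier_inversion_image:
  assumes "off_origin G"
  shows "frontier (inversion ` G) = inversion ` frontier G"
proof -
  have "open G" "0 \<notin> G" "compactly_inside G (- {0})"
    using assms closure_subset by (auto simp: off_origin_def compactly_inside_def)
  then show ?thesis
    using open_inversion_image[of G]
    by (simp add: frontier_def interior_open closure_inversion_image image_set_diff[OF inj_inversion])
qed

lemma zero_notin_inversion_image: "0 \<notin> V \<Longrightarrow> 0 \<notin> inversion ` V"
  by (auto dest: sym)

text \<open>
  Local notions on \<open>T(V)\<close> quantify over regions \<open>G\<close> inside \<open>T(V)\<close>; they are reduced to the regions
  \<open>T(G)\<close> inside \<open>V\<close>.
\<close>
lemma inner_regions_inversion: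
  assumes V: "0 \<notin> V" and G: "open G" "compactly_inside G (inversion ` V)"
  shows "off_origin (inversion ` G)" "open (inversion ` G)" "compactly_inside (inversion ` G) V"
proof -
  have "0 \<notin> inversion ` V"
    using V by (rule zero_notin_inversion_image)
  moreover have "G \<subseteq> inversion ` V"
    using G(2) closure_subset by (auto simp: compactly_inside_def)
  ultimately have "0 \<notin> G" by blast
  then show "open (inversion ` G)"
    using G(1) by (intro open_inversion_image)
  moreover show "compactly_inside (inversion ` G) V"
    using compactly_inside_inversion[OF G(2) \<open>0 \<notin> inversion ` V\<close>] by simp
  ultimately show "off_origin (inversion ` G)"
    using V by (rule off_origin_if_compactly_inside)
qed

section \<open>Change of variables under the inversion\<close>

lemma borel_measurable_inversion_jacobian [measurable]:
  "inversion_jacobian \<in> borel_measurable borel"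
  unfolding inversion_jacobian_def[abs_def] by measurable

text \<open>
  Preimages under the involution are images, and a differentiable map between spaces of equal
  dimension sends Lebesgue sets to Lebesgue sets.
\<close>
lemma lebesgue_measurable_inversion:
  "(inversion :: real^'n \<Rightarrow> real^'n) \<in> lebesgue \<rightarrow>\<^sub>M lebesgue"
proof (rule measurableI)
  fix A :: "(real^'n) set" assume A: "A \<in> sets lebesgue"
  have "inversion ` (A - {0}) \<in> sets lebesgue"
  proof (rule differentiable_image_in_sets_lebesgue)
    show "A - {0} \<in> sets lebesgue"
      using A by auto
    show "inversion differentiable_on (A - {0})"
      by (metis DiffD2 differentiableI differentiable_on_def has_derivative_inversion singletonI)
  qed simp
  moreover have "inversion ` (A \<inter> {0}) \<in> sets lebesgue"
    by (cases "0 \<in> A") auto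
  moreover have "inversion -` A = inversion ` (A - {0}) \<union> inversion ` (A \<inter> {0})"
    unfolding inversion_image_eq_vimage by auto
  ultimately have "inversion -` A \<in> sets lebesgue"
    by (metis sets.Un)
  then show "inversion -` A \<inter> space lebesgue \<in> sets lebesgue"
    by (metis Int_UNIV_right UNIV_I sets.Int sets.top space_lebesgue_on lebesgue_on_UNIV_eq)
qed simp

text \<open>
  The formula for the measure of a differentiable image, \<open>has_measure_differentiable_image\<close>, orders
  the coordinates, whence the well-ordered index type. The origin is removed from \<open>A\<close> since \<open>T\<close> is
  not differentiable there. Infinite measure is a separate case because the formula is about sets
  of finite measure; there the Jacobian cannot be integrable either.
\<close>
lemma emeasure_inversion_wellorder:
  fixes A :: "(real^'m::{finite,wellorder}) set"
  assumes A: "A \<in> sets lebesgue"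
  shows "(\<integral>\<^sup>+x. ennreal (inversion_jacobian x) * indicator A (inversion x) \<partial>lebesgue) = emeasure lebesgue A"
proof -
  define B where "B = A - {0}"
  define S where "S = inversion -` B"
  have [measurable]: "B \<in> sets lebesgue" using A by (auto simp: B_def)
  have S [measurable]: "S \<in> sets lebesgue"
    using measurable_sets[OF lebesgue_measurable_inversion \<open>B \<in> sets lebesgue\<close>] by (simp add: S_def)
  have S0: "x \<noteq> 0" if "x \<in> S" for x
    using that by (auto simp: S_def B_def)
  have img: "inversion ` S = B"
    unfolding inversion_image_eq_vimage by (auto simp: S_def)
  have cov: "B \<in> lmeasurable \<and> measure lebesgue B = m \<longleftrightarrow> (inversion_jacobian has_integral m) S" for m
  proof -
    have "B \<in> lmeasurable \<and> measure lebesgue B = m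
        \<longleftrightarrow> ((\<lambda>x. \<bar>det (matrix (inversion_deriv x))\<bar>) has_integral m) S"
      using has_measure_differentiable_image[OF S has_derivative_inversion[OF S0] inj_inversion]
      unfolding img .
    also have "\<dots> \<longleftrightarrow> (inversion_jacobian has_integral m) S"
      by (rule has_integral_cong) (simp add: abs_det_inversion_deriv S0)
    finally show ?thesis .
  qed
  have "(\<integral>\<^sup>+x. ennreal (inversion_jacobian x) * indicator A (inversion x) \<partial>lebesgue)
      = (\<integral>\<^sup>+x. indicator S x * inversion_jacobian x \<partial>lebesgue)"
  proof (rule nn_integral_cong)
    fix x
    have "x = 0 \<or> (inversion x \<in> A \<longleftrightarrow> x \<in> S)"
      by (auto simp: S_def B_def)
    then show "ennreal (inversion_jacobian x) * indicator A (inversion x)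
        = indicator S x * inversion_jacobian x"
      by (auto simp: indicator_def)
  qed
  moreover have "emeasure lebesgue A = emeasure lebesgue B"
    unfolding B_def by (rule emeasure_Diff_null_set[symmetric]) (use A in auto)
  moreover have "(\<integral>\<^sup>+x. indicator S x * inversion_jacobian x \<partial>lebesgue) = emeasure lebesgue B"
  proof (cases "B \<in> lmeasurable")
    case True
    then have "(inversion_jacobian has_integral measure lebesgue B) S"
      using cov by blast
    then show ?thesis
      using nn_integral_has_integral_lebesgue[of S inversion_jacobian] True
      by (simp add: emeasure_eq_measure2 nn_integral_completion)
  next
    case False
    then have inf: "emeasure lebesgue B = \<infinity>"
      using \<open>B \<in> sets lebesgue\<close> by (metis fmeasurableI infinity_ennreal_def top.not_eq_extremum)
    have "(\<integral>\<^sup>+x. indicator S x * inversion_jacobian x \<partial>lebesgue) = \<infinity>"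
    proof (rule ccontr)
      assume *: "(\<integral>\<^sup>+x. indicator S x * inversion_jacobian x \<partial>lebesgue) \<noteq> \<infinity>"
      have [measurable]: "inversion_jacobian \<in> borel_measurable lebesgue"
        by (simp add: measurable_completion)
      have "integrable lebesgue (\<lambda>x. indicator S x * inversion_jacobian x)"
        using * by (intro integrableI_nonneg) (auto simp: top.not_eq_extremum ennreal_mult' ennreal_indicator)
      then have "inversion_jacobian absolutely_integrable_on S"
        by (simp add: set_integrable_def)
      then have "inversion_jacobian integrable_on S"
        using set_lebesgue_integral_eq_integral(1) by blast
      then show False using cov False by (auto simp: integrable_on_def)
    qed
    then show ?thesis using inf by simp
  qed
  ultimately show ?thesis by simp
qed

text \<open>
  A copy of a finite index type, well-ordered by some numbering of its elements. Renaming the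
  coordinates along this copy is an isometry that preserves Lebesgue measure and commutes with the
  inversion, which carries the change of variables over to an arbitrary finite index type.
\<close>
typedef (overloaded) 'a ordered = "UNIV :: 'a set"
  morphisms of_ordered to_ordered by simp

lemma bij_to_ordered: "bij to_ordered"
  by (metis bij_betw_def injI surj_def of_ordered_inverse to_ordered_inject UNIV_I)

instance ordered :: (finite) finite
proof
  show "finite (UNIV :: 'a ordered set)"
    using bij_to_ordered by (metis bij_betw_finite finite)
qed

instantiation ordered :: (finite) wellorder
begin

definition less_eq_ordered :: "'a ordered \<Rightarrow> 'a ordered \<Rightarrow> bool"
  where "x \<le> y \<longleftrightarrow> to_nat (of_ordered x) \<le> to_nat (of_ordered y)"

definition less_ordered :: "'a ordered \<Rightarrow> 'a ordered \<Rightarrow> bool"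
  where "x < y \<longleftrightarrow> to_nat (of_ordered x) < to_nat (of_ordered y)"

instance
proof
  fix P :: "'a ordered \<Rightarrow> bool" and a
  assume *: "\<And>x. (\<And>y. y < x \<Longrightarrow> P y) \<Longrightarrow> P x"
  show "P a"
    by (induction a rule: measure_induct_rule[where f = "\<lambda>x. to_nat (of_ordered x)"])
       (rule *, simp add: less_ordered_def)
qed (auto simp: less_eq_ordered_def less_ordered_def of_ordered_inject)

end

definition reindex :: "real^'n ordered \<Rightarrow> real^'n"
  where "reindex y = (\<chi> i. y $ to_ordered i)"

definition unreindex :: "real^'n \<Rightarrow> real^'n ordered"
  where "unreindex x = (\<chi> i. x $ of_ordered i)"

lemma reindex_unreindex [simp]: "reindex (unreindex x) = x"
  by (simp add: reindex_def unreindex_def vec_eq_iff to_ordered_inverse)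

lemma unreindex_reindex [simp]: "unreindex (reindex y) = y"
  by (simp add: reindex_def unreindex_def vec_eq_iff of_ordered_inverse)

lemma inner_reindex: "reindex y \<bullet> reindex z = y \<bullet> z"
  unfolding inner_vec_def reindex_def
  using sum.reindex_bij_betw[OF bij_to_ordered, of "\<lambda>i. y $ i \<bullet> z $ i"] by simp

lemma norm_reindex [simp]: "norm (reindex y) = norm y"
  by (simp add: norm_eq_sqrt_inner inner_reindex)

lemma inversion_reindex: "inversion (reindex y) = reindex (inversion y)"
  unfolding inversion_def norm_reindex by (simp add: reindex_def vec_eq_iff)

lemma card_ordered: "CARD('n ordered) = CARD('n::finite)"
  by (rule bij_betw_same_card[OF bij_to_ordered, symmetric])

lemma inversion_jacobian_reindex: "inversion_jacobian (reindex y) = inversion_jacobian y"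
  by (simp add: inversion_jacobian_def card_ordered)

lemma linear_reindex: "linear reindex"
  by (rule linearI) (simp_all add: reindex_def vec_eq_iff)

lemma borel_measurable_reindex [measurable]: "reindex \<in> borel_measurable borel"
  using linear_continuous_on[OF linear_conv_bounded_linear[THEN iffD1, OF linear_reindex]]
  by (rule borel_measurable_continuous_onI)

lemma emeasure_lborel_box_vec:
  fixes l u :: "real^'n"
  assumes "\<And>i. l $ i \<le> u $ i"
  shows "emeasure lborel (box l u) = (\<Prod>i\<in>UNIV. u $ i - l $ i)"
proof -
  have "measure lborel (cbox l u) = (\<Prod>i\<in>UNIV. u $ i - l $ i)"
    using assms by (intro content_cbox_cart) (metis assms empty_iff mem_box_cart(2) order_refl)
  moreover have "emeasure lborel (box l u) = emeasure lborel (cbox l u)"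
    by (simp add: emeasure_lborel_box_eq emeasure_lborel_cbox_eq)
  moreover have "emeasure lborel (cbox l u) = ennreal (measure lborel (cbox l u))"
    by (intro emeasure_eq_ennreal_measure) (metis emeasure_lborel_cbox_finite infinity_ennreal_def less_irrefl)
  ultimately show ?thesis by simp
qed

text \<open>
  Lebesgue measure is determined by its values on boxes, and renaming the coordinates only permutes
  the factors of the volume of a box.
\<close>
lemma lborel_eq_distr_reindex: "(lborel :: (real^'n) measure) = distr lborel borel reindex"
proof (rule lborel_eqI)
  fix l u :: "real^'n"
  assume lu: "\<And>b. b \<in> Basis \<Longrightarrow> l \<bullet> b \<le> u \<bullet> b"
  have le: "l $ i \<le> u $ i" for i
    using lu[of "axis i 1"] by (simp add: inner_axis)
  have "reindex -` box l u \<inter> space lborel = box (unreindex l) (unreindex u)"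
    by (simp add: set_eq_iff mem_box_cart reindex_def unreindex_def)
       (metis of_ordered_inverse to_ordered_inverse UNIV_I)
  then have "emeasure (distr lborel borel reindex) (box l u)
      = emeasure lborel (box (unreindex l) (unreindex u))"
    by (subst emeasure_distr) auto
  also have "\<dots> = (\<Prod>i\<in>UNIV. unreindex u $ i - unreindex l $ i)"
    by (rule emeasure_lborel_box_vec) (simp add: unreindex_def le)
  also have "(\<Prod>i\<in>UNIV. unreindex u $ i - unreindex l $ i) = (\<Prod>i\<in>UNIV. u $ i - l $ i)"
    using prod.reindex_bij_betw[OF bij_to_ordered, of "\<lambda>i. unreindex u $ i - unreindex l $ i"]
    by (simp add: unreindex_def to_ordered_inverse)
  also have "\<dots> = (\<Prod>b\<in>Basis. (u - l) \<bullet> b)"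
    unfolding Basis_vec_def
    by (subst prod.UNION_disjoint) (auto simp: axis_eq_axis inner_axis)
  finally show "emeasure (distr lborel borel reindex) (box l u) = (\<Prod>b\<in>Basis. (u - l) \<bullet> b)" .
qed simp

lemma null_sets_lborel_eq_distr_reindex:
  "null_sets (lborel :: (real^'n) measure) = null_sets (distr lebesgue lborel reindex)"
  by (subst lborel_eq_distr_reindex) (simp add: distr_completion null_sets_def cong: distr_cong)

lemma lebesgue_measurable_reindex: "reindex \<in> lebesgue \<rightarrow>\<^sub>M (lebesgue :: (real^'n) measure)"
  by (simp add: completion.measurable_completion2 null_sets_lborel_eq_distr_reindex measurable_completion)

text \<open>The Borel version passes to the completions because both sides have the same null sets.\<close>
lemma lebesgue_eq_distr_reindex: "(lebesgue :: (real^'n) measure) = distr lebesgue lebesgue reindex"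
proof -
  have "(lebesgue :: (real^'n) measure) = completion (distr lborel borel reindex)"
    using lborel_eq_distr_reindex by metis
  also have "\<dots> = completion (distr lebesgue lborel reindex)"
    by (simp add: distr_completion cong: distr_cong)
  also have "\<dots> = distr lebesgue lebesgue reindex"
    by (subst completion.completion_distr_eq)
       (auto simp: null_sets_lborel_eq_distr_reindex measurable_completion)
  finally show ?thesis .
qed

text \<open>
  The change of variables \<open>y = T(x)\<close>, \<open>dy = |J\<^sub>T(x)| dx\<close>, as an identity of measures on the whole
  space; the origin is a null set on both sides.
\<close>
lemma lebesgue_eq_distr_inversion:
  "(lebesgue :: (real^'n) measure) = distr (density lebesgue inversion_jacobian) lebesgue inversion"
proof (rule measure_eqI)
  fix A :: "(real^'n) set" assume A: "A \<in> sets lebesgue"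
  note [measurable] = lebesgue_measurable_inversion lebesgue_measurable_reindex A
  have [measurable]: "(inversion_jacobian :: real^'n \<Rightarrow> real) \<in> borel_measurable lebesgue"
    by (simp add: measurable_completion)
  have [measurable]: "inversion -` A \<in> sets lebesgue"
    using measurable_sets[OF lebesgue_measurable_inversion A] by simp
  define B where "B = reindex -` A \<inter> space lebesgue"
  have B [measurable]: "B \<in> sets lebesgue"
    unfolding B_def by measurable
  have "emeasure (distr (density lebesgue inversion_jacobian) lebesgue inversion) A
      = (\<integral>\<^sup>+x. ennreal (inversion_jacobian x) * indicator A (inversion x) \<partial>lebesgue)"
    by (subst emeasure_distr) (auto simp: emeasure_density indicator_def intro!: nn_integral_cong)
  also have "\<dots> = (\<integral>\<^sup>+x. ennreal (inversion_jacobian x) * indicator A (inversion x) \<partial>distr lebesgue lebesgue reindex)"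
    by (simp flip: lebesgue_eq_distr_reindex)
  also have "\<dots> = (\<integral>\<^sup>+y. ennreal (inversion_jacobian (reindex y)) * indicator A (inversion (reindex y)) \<partial>lebesgue)"
    by (rule nn_integral_distr) measurable
  also have "\<dots> = (\<integral>\<^sup>+y. ennreal (inversion_jacobian y) * indicator B (inversion y) \<partial>lebesgue)"
    by (simp add: inversion_jacobian_reindex inversion_reindex B_def indicator_def)
  also have "\<dots> = emeasure lebesgue B"
    by (rule emeasure_inversion_wellorder) measurable
  also have "\<dots> = emeasure (distr lebesgue lebesgue reindex) A"
    unfolding B_def by (rule emeasure_distr[symmetric]) measurable
  also have "\<dots> = emeasure lebesgue A"
    by (simp flip: lebesgue_eq_distr_reindex)
  finally show "emeasure lebesgue A = emeasure (distr (density lebesgue inversion_jacobian) lebesgue inversion) A" ..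
qed simp

lemma nn_integral_inversion:
  fixes f :: "real^'n \<Rightarrow> ennreal"
  assumes "f \<in> borel_measurable lebesgue"
  shows "(\<integral>\<^sup>+x. ennreal (inversion_jacobian x) * f (inversion x) \<partial>lebesgue) = (\<integral>\<^sup>+x. f x \<partial>lebesgue)"
proof -
  have j: "inversion_jacobian \<in> borel_measurable (lebesgue :: (real^'n) measure)"
    by (simp add: measurable_completion)
  have "(\<integral>\<^sup>+x. f x \<partial>lebesgue) = (\<integral>\<^sup>+x. f x \<partial>distr (density lebesgue inversion_jacobian) lebesgue inversion)"
    by (simp flip: lebesgue_eq_distr_inversion)
  also have "\<dots> = (\<integral>\<^sup>+x. f (inversion x) \<partial>density lebesgue inversion_jacobian)"
    using assms lebesgue_measurable_inversion by (intro nn_integral_distr) auto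
  also have "\<dots> = (\<integral>\<^sup>+x. ennreal (inversion_jacobian x) * f (inversion x) \<partial>lebesgue)"
    using j measurable_compose[OF lebesgue_measurable_inversion assms] by (intro nn_integral_density) auto
  finally show ?thesis ..
qed

text \<open>
  For measurable integrands this is the preceding change of variables. If one integrand is not
  measurable then neither is the other, as \<open>T\<close> is an involution and the Jacobian is nonzero off the
  origin; both integrals are then \<open>0\<close> by convention.
\<close>
lemma integral_inversion_set:
  fixes F :: "real^'n \<Rightarrow> real"
  assumes "0 \<notin> V"
  shows "(LINT x:inversion ` V|lebesgue. inversion_jacobian x * F (inversion x)) = (LINT x:V|lebesgue. F x)"
proof -
  define G where "G x = indicator V x * F x" for x
  define H where "H x = inversion_jacobian x * G (inversion x)" for x
  have j: "inversion_jacobian \<in> borel_measurable (lebesgue :: (real^'n) measure)"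
    by (simp add: measurable_completion)
  have G0: "G 0 = 0"
    using assms by (simp add: G_def)
  have "G \<in> borel_measurable lebesgue" if "H \<in> borel_measurable lebesgue"
  proof -
    have "G x = inversion_jacobian x * H (inversion x)" for x
      using inversion_jacobian_mult_inversion[of x]
      by (cases "x = 0") (simp_all add: G0 H_def flip: mult.assoc)
    then show ?thesis
      using j measurable_compose[OF lebesgue_measurable_inversion that] by (simp cong: measurable_cong)
  qed
  have "integral\<^sup>L lebesgue H = integral\<^sup>L lebesgue G"
  proof (cases "G \<in> borel_measurable lebesgue")
    case True
    have "integral\<^sup>L lebesgue G = integral\<^sup>L (distr (density lebesgue inversion_jacobian) lebesgue inversion) G"
      by (simp flip: lebesgue_eq_distr_inversion)
    also have "\<dots> = integral\<^sup>L (density lebesgue inversion_jacobian) (\<lambda>x. G (inversion x))"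
      using True lebesgue_measurable_inversion by (intro integral_distr) auto
    also have "\<dots> = integral\<^sup>L lebesgue (\<lambda>x. inversion_jacobian x *\<^sub>R G (inversion x))"
      using j measurable_compose[OF lebesgue_measurable_inversion True] by (intro integral_density) auto
    finally show ?thesis by (simp add: H_def[abs_def])
  next
    case False
    then have "H \<notin> borel_measurable lebesgue"
      using \<open>H \<in> borel_measurable lebesgue \<Longrightarrow> G \<in> borel_measurable lebesgue\<close> by blast
    with False show ?thesis
      by (metis borel_measurable_integrable not_integrable_integral_eq)
  qed
  moreover have "indicator (inversion ` V) x *\<^sub>R (inversion_jacobian x * F (inversion x)) = H x" for x
    by (simp add: H_def G_def inversion_image_eq_vimage indicator_def)
  ultimately show ?thesis
    by (simp add: set_lebesgue_integral_def G_def[abs_def])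
qed

lemma measurable_comp_inversion:
  assumes "f \<in> lebesgue_on V \<rightarrow>\<^sub>M N"
  shows "(\<lambda>x. f (inversion x)) \<in> lebesgue_on (inversion ` V) \<rightarrow>\<^sub>M N"
proof (rule measurable_compose[OF _ assms])
  show "inversion \<in> lebesgue_on (inversion ` V) \<rightarrow>\<^sub>M lebesgue_on V"
    by (rule measurable_restrict_space3[OF lebesgue_measurable_inversion]) auto
qed

section \<open>Composition of smooth functions with the inversion\<close>

lemma Ck_on_cong:
  assumes "open V" and "\<And>x. x \<in> V \<Longrightarrow> f x = g x"
  shows "Ck_on k V f \<longleftrightarrow> Ck_on k V g"
  using assms(2)
proof (induction k arbitrary: f g)
  case 0
  then show ?case by (simp cong: continuous_on_cong)
next
  case (Suc k)
  have "(f has_derivative D) (at x) \<longleftrightarrow> (g has_derivative D) (at x)" if "x \<in> V" for x D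
    using has_derivative_transform_within_open[OF _ assms(1) that] Suc.prems by metis
  then have "f differentiable (at x) \<longleftrightarrow> g differentiable (at x)"
      and "frechet_derivative f (at x) = frechet_derivative g (at x)" if "x \<in> V" for x
    using that by (simp_all add: differentiable_def frechet_derivative_def)
  then show ?case
    using Suc.IH[of "\<lambda>x. frechet_derivative f (at x) _" "\<lambda>x. frechet_derivative g (at x) _"] by simp
qed

text \<open>
  The derivative may be given by any formula valid on \<open>V\<close>. The closure properties under sums,
  products, reciprocals and composition rest on this: differentiate by the usual rule, then use
  induction on the order.
\<close>
lemma Ck_on_Suc_has_derivativeI:
  assumes "open V"
    and "\<And>x. x \<in> V \<Longrightarrow> (f has_derivative f' x) (at x)"
    and "\<And>h. Ck_on k V (\<lambda>x. f' x h)"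
  shows "Ck_on (Suc k) V f"
proof -
  have "frechet_derivative f (at x) = f' x" if "x \<in> V" for x
    using frechet_derivative_at[OF assms(2)[OF that]] by simp
  then have "Ck_on k V (\<lambda>x. frechet_derivative f (at x) h)" for h
    using assms(3)[of h] by (subst Ck_on_cong[OF assms(1), where g = "\<lambda>x. f' x h"]) simp_all
  then show ?thesis
    using assms(2) by (auto simp: differentiable_def)
qed

lemma Ck_on_Suc_has_derivative:
  "Ck_on (Suc k) V f \<Longrightarrow> x \<in> V \<Longrightarrow> (f has_derivative frechet_derivative f (at x)) (at x)"
  using frechet_derivative_works by auto

lemma Ck_on_Suc_imp: "Ck_on (Suc k) V f \<Longrightarrow> Ck_on k V f"
proof (induction k arbitrary: f)
  case 0
  then show ?case
    by (auto intro!: continuous_at_imp_continuous_on differentiable_imp_continuous_within)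
next
  case (Suc k)
  from Suc.prems have "(\<forall>x\<in>V. f differentiable (at x)) \<and> (\<forall>h. Ck_on (Suc k) V (\<lambda>x. frechet_derivative f (at x) h))"
    by (rule Ck_on.simps(2)[THEN iffD1])
  then show ?case
    using Suc.IH unfolding Ck_on.simps(2)[of k V f] by blast
qed

lemma Ck_on_subset: "Ck_on k V f \<Longrightarrow> W \<subseteq> V \<Longrightarrow> Ck_on k W f"
  by (induction k arbitrary: f) (auto intro: continuous_on_subset)

lemma Ck_on_Un:
  assumes "open V" "open W"
  shows "Ck_on k V f \<Longrightarrow> Ck_on k W f \<Longrightarrow> Ck_on k (V \<union> W) f"
  by (induction k arbitrary: f) (use assms in \<open>auto intro: continuous_on_open_Un\<close>)

lemma Ck_on_const: "open V \<Longrightarrow> Ck_on k V (\<lambda>_. c)"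
proof (induction k arbitrary: c)
  case (Suc k)
  then show ?case
    by (intro Ck_on_Suc_has_derivativeI[where f' = "\<lambda>_ _. 0"]) auto
qed simp

lemma Ck_on_add:
  assumes "open V"
  shows "Ck_on k V f \<Longrightarrow> Ck_on k V g \<Longrightarrow> Ck_on k V (\<lambda>x. f x + g x)"
proof (induction k arbitrary: f g)
  case (Suc k)
  show ?case
  proof (rule Ck_on_Suc_has_derivativeI[OF assms])
    show "((\<lambda>x. f x + g x) has_derivative
        (\<lambda>h. frechet_derivative f (at x) h + frechet_derivative g (at x) h)) (at x)" if "x \<in> V" for x
      using Suc.prems that by (intro has_derivative_add Ck_on_Suc_has_derivative)
  qed (use Suc in auto)
qed (auto intro: continuous_intros)

lemma Ck_on_mult:
  assumes "open V"
  shows "Ck_on k V f \<Longrightarrow> Ck_on k V g \<Longrightarrow> Ck_on k V (\<lambda>x. f x * g x)"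
proof (induction k arbitrary: f g)
  case (Suc k)
  show ?case
  proof (rule Ck_on_Suc_has_derivativeI[OF assms])
    show "((\<lambda>x. f x * g x) has_derivative
        (\<lambda>h. f x * frechet_derivative g (at x) h + frechet_derivative f (at x) h * g x)) (at x)"
      if "x \<in> V" for x
      using Suc.prems that by (intro has_derivative_mult Ck_on_Suc_has_derivative)
    show "Ck_on k V (\<lambda>x. f x * frechet_derivative g (at x) h + frechet_derivative f (at x) h * g x)" for h
      using Suc.prems Suc.prems[THEN Ck_on_Suc_imp] by (intro Ck_on_add assms Suc.IH) simp_all
  qed
qed (auto intro: continuous_intros)

lemma Ck_on_sum:
  assumes "open V" and "\<And>i. i \<in> I \<Longrightarrow> Ck_on k V (f i)"
  shows "Ck_on k V (\<lambda>x. \<Sum>i\<in>I. f i x)"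
  using assms(2)
  by (induction I rule: infinite_finite_induct) (auto intro: Ck_on_add Ck_on_const assms(1))

lemma Ck_on_inverse:
  assumes "open V" and nz: "\<And>x. x \<in> V \<Longrightarrow> f x \<noteq> 0"
  shows "Ck_on k V f \<Longrightarrow> Ck_on k V (\<lambda>x. inverse (f x))"
proof (induction k)
  case (Suc k)
  have inv: "Ck_on k V (\<lambda>x. inverse (f x))"
    using Suc Ck_on_Suc_imp by blast
  show ?case
  proof (rule Ck_on_Suc_has_derivativeI[OF assms(1)])
    show "((\<lambda>x. inverse (f x)) has_derivative
        (\<lambda>h. - 1 * (inverse (f x) * frechet_derivative f (at x) h * inverse (f x)))) (at x)"
      if "x \<in> V" for x
      using Deriv.has_derivative_inverse[OF nz[OF that] Ck_on_Suc_has_derivative[OF Suc.prems that]]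
      by simp
    show "Ck_on k V (\<lambda>x. - 1 * (inverse (f x) * frechet_derivative f (at x) h * inverse (f x)))" for h
      using Suc.prems inv by (intro Ck_on_mult Ck_on_const assms(1)) auto
  qed
qed (auto intro!: continuous_intros dest: nz)

lemma Ck_on_bounded_linear:
  assumes "open V" "bounded_linear f"
  shows "Ck_on k V f"
proof (cases k)
  case 0
  then show ?thesis
    using assms(2) by (simp add: linear_continuous_on)
next
  case (Suc j)
  show ?thesis
    unfolding Suc using assms
    by (intro Ck_on_Suc_has_derivativeI[where f' = "\<lambda>_. f"])
       (auto intro: bounded_linear_imp_has_derivative Ck_on_const)
qed

text \<open>
  By the chain rule the derivative of \<open>f \<circ> g\<close> in direction \<open>h\<close> is a sum, over the basis, of products
  of derivatives of the components of \<open>g\<close> with partial derivatives of \<open>f\<close> composed with \<open>g\<close>; the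
  latter are one order less smooth than \<open>f\<close>, which closes the induction.
\<close>
lemma Ck_on_compose:
  fixes g :: "'a::euclidean_space \<Rightarrow> 'b::euclidean_space"
  assumes V: "open V" and im: "g ` V \<subseteq> U"
  shows "Ck_on k U f \<Longrightarrow> (\<And>b. b \<in> Basis \<Longrightarrow> Ck_on k V (\<lambda>x. g x \<bullet> b)) \<Longrightarrow> Ck_on k V (\<lambda>x. f (g x))"
proof (induction k arbitrary: f)
  case 0
  then have "continuous_on V g"
    by (subst continuous_on_componentwise) auto
  then show ?case
    using 0 im by (auto intro: continuous_on_compose2)
next
  case (Suc k)
  define Dg where "Dg x h = (\<Sum>b\<in>Basis. frechet_derivative (\<lambda>x. g x \<bullet> b) (at x) h *\<^sub>R b)" for x h
  have Dg_inner: "Dg x h \<bullet> b = frechet_derivative (\<lambda>x. g x \<bullet> b) (at x) h" if "b \<in> Basis" for x h b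
    using that by (simp add: Dg_def inner_sum_left inner_Basis if_distrib sum.delta cong: if_cong)
  have Dg: "(g has_derivative Dg x) (at x)" if "x \<in> V" for x
    by (subst has_derivative_componentwise_within)
       (use Ck_on_Suc_has_derivative[OF Suc.prems(2) that] in \<open>auto simp: Dg_inner\<close>)
  show ?case
  proof (rule Ck_on_Suc_has_derivativeI[OF V])
    fix x assume x: "x \<in> V"
    let ?D = "frechet_derivative f (at (g x))"
    have D: "(f has_derivative ?D) (at (g x))"
      using Suc.prems(1) x im by (intro Ck_on_Suc_has_derivative) auto
    then have "linear ?D" by (rule has_derivative_linear)
    have "((\<lambda>x. f (g x)) has_derivative (\<lambda>h. ?D (Dg x h))) (at x)"
      by (rule has_derivative_compose[OF Dg[OF x] D])
    moreover have "?D (Dg x h) = (\<Sum>b\<in>Basis. frechet_derivative (\<lambda>x. g x \<bullet> b) (at x) h * ?D b)" for h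
      using \<open>linear ?D\<close> by (simp add: Dg_def linear_sum linear_cmul)
    ultimately show "((\<lambda>x. f (g x)) has_derivative
        (\<lambda>h. \<Sum>b\<in>Basis. frechet_derivative (\<lambda>x. g x \<bullet> b) (at x) h * ?D b)) (at x)"
      by simp
  next
    fix h
    have "Ck_on k V (\<lambda>x. frechet_derivative f (at (g x)) b)" for b
      using Suc.prems(1) Suc.prems(2)[THEN Ck_on_Suc_imp]
      by (intro Suc.IH[of "\<lambda>y. frechet_derivative f (at y) b"]) auto
    then show "Ck_on k V (\<lambda>x. \<Sum>b\<in>Basis. frechet_derivative (\<lambda>x. g x \<bullet> b) (at x) h *
        frechet_derivative f (at (g x)) b)"
      using Suc.prems(2) by (intro Ck_on_sum Ck_on_mult V) auto
  qed
qed

lemma Ck_on_inversion_component: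
  assumes "open V" "0 \<notin> V"
  shows "Ck_on k V (\<lambda>x. inversion x \<bullet> b)"
proof -
  have sq: "(\<Sum>c\<in>Basis. (x \<bullet> c) * (x \<bullet> c)) = x \<bullet> x" for x :: "real^'n"
    by (rule euclidean_inner[symmetric])
  have "Ck_on k V (\<lambda>x. \<Sum>c\<in>Basis. (x \<bullet> c) * (x \<bullet> c))"
    using assms by (intro Ck_on_sum Ck_on_mult Ck_on_bounded_linear bounded_linear_inner_left)
  then have "Ck_on k V (\<lambda>x. inverse (x \<bullet> x))"
    unfolding sq by (rule Ck_on_inverse[OF assms(1), rotated]) (use assms in auto)
  then have "Ck_on k V (\<lambda>x. inverse (x \<bullet> x) * (x \<bullet> b))"
    by (rule Ck_on_mult[OF assms(1) _ Ck_on_bounded_linear[OF assms(1) bounded_linear_inner_left]])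
  then show ?thesis
    by (simp add: inversion_def power2_norm_eq_inner)
qed

lemma smooth_on_comp_inversion:
  assumes "smooth_on V f" "open V" "0 \<notin> V"
  shows "smooth_on (inversion ` V) (f \<circ> inversion)"
proof -
  have "open (inversion ` V)"
    using assms(2,3) by (rule open_inversion_image)
  have "0 \<notin> inversion ` V"
    using assms(3) by (auto dest: sym)
  have "Ck_on k (inversion ` V) (\<lambda>x. f (inversion x))" for k
  proof (rule Ck_on_compose[where f = f and g = inversion and U = V])
    show "Ck_on k V f"
      using assms(1) by (simp add: smooth_on_def)
    show "Ck_on k (inversion ` V) (\<lambda>x. inversion x \<bullet> b)" for b
      by (rule Ck_on_inversion_component) fact+
  qed (use \<open>open (inversion ` V)\<close> in simp_all)
  then show ?thesis
    by (simp add: smooth_on_def comp_def)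
qed

lemma GDERIV_unique:
  assumes "GDERIV f x :> D" "GDERIV f x :> E"
  shows "D = E"
proof -
  have "(\<lambda>h. h \<bullet> D) = (\<lambda>h. h \<bullet> E)"
    using assms unfolding gderiv_def by (rule has_derivative_unique)
  from fun_cong[OF this, of "D - E"] have "(D - E) \<bullet> (D - E) = 0"
    by (simp only: inner_diff_right)
  then show ?thesis by simp
qed

lemma grad_eqI: "GDERIV f x :> D \<Longrightarrow> grad f x = D"
  unfolding grad_def by (rule the_equality) (auto intro: GDERIV_unique)

lemma GDERIV_grad:
  fixes f :: "'a::euclidean_space \<Rightarrow> real"
  assumes "f differentiable (at x)"
  shows "GDERIV f x :> grad f x"
proof -
  obtain f' where f': "(f has_derivative f') (at x)"
    using assms by (auto simp: differentiable_def)
  then have "linear f'" by (rule has_derivative_linear)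
  define D where "D = (\<Sum>b\<in>Basis. f' b *\<^sub>R b)"
  have "f' = (\<lambda>h. h \<bullet> D)"
  proof
    fix h
    have "f' h = f' (\<Sum>b\<in>Basis. (h \<bullet> b) *\<^sub>R b)" by (simp add: euclidean_representation)
    also have "\<dots> = h \<bullet> D"
      using \<open>linear f'\<close> by (simp add: linear_sum linear_cmul D_def inner_sum_right mult.commute)
    finally show "f' h = h \<bullet> D" .
  qed
  then have "GDERIV f x :> D"
    using f' unfolding gderiv_def by presburger
  then show ?thesis
    using grad_eqI by blast
qed

text \<open>The chain rule gives the adjoint of \<open>dT(x)\<close>, which is \<open>dT(x)\<close> itself.\<close>
lemma grad_comp_inversion:
  assumes "f differentiable (at (inversion x))" "x \<noteq> 0"
  shows "grad (f \<circ> inversion) x = inversion_deriv x (grad f (inversion x))"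
proof (rule grad_eqI)
  have "(f has_derivative (\<lambda>h. h \<bullet> grad f (inversion x))) (at (inversion x))"
    using GDERIV_grad[OF assms(1)] by (simp add: gderiv_def)
  from has_derivative_compose[OF has_derivative_inversion[OF assms(2)] this]
  show "GDERIV (f \<circ> inversion) x :> inversion_deriv x (grad f (inversion x))"
    by (simp add: gderiv_def inversion_deriv_selfadjoint comp_def)
qed

lemma Ck_on_open_cover:
  assumes "open V" "open W" "V \<union> W = UNIV" "Ck_on k V f" "Ck_on k W f"
  shows "Ck_on k UNIV f"
  using Ck_on_Un[OF assms(1,2,4,5)] assms(3) by simp

text \<open>
  Smoothness on the whole space is the point: off the origin it is the chain rule, and near the
  origin \<open>\<phi> \<circ> T\<close> vanishes, because its support is the inverted support of \<open>\<phi>\<close> and this is a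
  compact set that avoids the origin.
\<close>
lemma test_function_inversion:
  assumes \<phi>: "test_function V \<phi>" and "0 \<notin> V"
  shows "test_function (inversion ` V) (\<phi> \<circ> inversion)"
proof -
  define S where "S = {x. \<phi> x \<noteq> 0}"
  have S: "compactly_inside S V" and smooth: "smooth_on UNIV \<phi>"
    using \<phi> by (auto simp: test_function_def S_def)
  have S_eq: "{x. (\<phi> \<circ> inversion) x \<noteq> 0} = inversion ` S"
    unfolding inversion_image_eq_vimage S_def by auto
  have inside: "compactly_inside (inversion ` S) (inversion ` V)"
    by (rule compactly_inside_inversion[OF S assms(2)])
  have img: "inversion ` (- {0}) = (- {0} :: (real^'n) set)"
    unfolding inversion_image_eq_vimage by auto
  have "Ck_on k UNIV (\<phi> \<circ> inversion)" for k
  proof (rule Ck_on_open_cover)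
    have "smooth_on (- {0}) \<phi>"
      using smooth Ck_on_subset unfolding smooth_on_def by blast
    then have "smooth_on (inversion ` (- {0})) (\<phi> \<circ> inversion)"
      by (rule smooth_on_comp_inversion) auto
    then show "Ck_on k (- {0}) (\<phi> \<circ> inversion)"
      by (simp add: img smooth_on_def)
    have "\<phi> (inversion x) = 0" if "x \<in> - closure (inversion ` S)" for x
    proof -
      have "x \<notin> {x. (\<phi> \<circ> inversion) x \<noteq> 0}"
        unfolding S_eq using that closure_subset[of "inversion ` S"] by (metis Compl_iff subsetD)
      then show ?thesis by simp
    qed
    then show "Ck_on k (- closure (inversion ` S)) (\<phi> \<circ> inversion)"
      by (subst Ck_on_cong[where g = "\<lambda>_. 0"]) (auto intro: Ck_on_const)
    show "- {0} \<union> - closure (inversion ` S) = UNIV"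
      using inside zero_notin_inversion_image[OF assms(2)] by (auto simp: compactly_inside_def)
  qed auto
  then show ?thesis
    using inside by (simp only: test_function_def smooth_on_def S_eq) blast
qed

section \<open>Weighted Lebesgue and Sobolev spaces under the inversion\<close>

lemma space_weighted_on [simp]: "space (weighted_on \<omega> V) = V"
  by (simp add: weighted_on_def)

lemma measurable_weighted_on [simp]: "measurable (weighted_on \<omega> V) N = measurable (lebesgue_on V) N"
  by (rule measurable_cong_sets) (simp_all add: weighted_on_def)

lemma nn_integral_weighted_on:
  assumes V: "V \<in> sets lebesgue" and "\<omega> \<in> borel_measurable (lebesgue_on V)"
    and "h \<in> borel_measurable (lebesgue_on V)"
  shows "(\<integral>\<^sup>+x. h x \<partial>weighted_on \<omega> V) = (\<integral>\<^sup>+x. ennreal (\<omega> x) * h x * indicator V x \<partial>lebesgue)"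
  using assms unfolding weighted_on_def
  by (subst nn_integral_density) (auto simp: nn_integral_restrict_space)

text \<open>
  The common properties of the weights \<open>1\<close> and \<open>|\<xi>|\<close> to the power \<open>2(p-n)\<close>; the latter vanishes at
  the origin, so the condition is imposed only away from it.
\<close>
definition admissible_weight :: "('a::euclidean_space \<Rightarrow> real) \<Rightarrow> bool"
  where "admissible_weight \<omega> \<longleftrightarrow> continuous_on (- {0}) \<omega> \<and> (\<forall>x. x \<noteq> 0 \<longrightarrow> 0 < \<omega> x)"

lemma measurable_admissible_weight:
  assumes "admissible_weight \<omega>" "V \<in> sets lebesgue" "0 \<notin> V"
  shows "\<omega> \<in> borel_measurable (lebesgue_on V)"
  using assms
  by (auto simp: admissible_weight_def intro!: continuous_imp_measurable_on_sets_lebesgue elim!: continuous_on_subset)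

text \<open>
  After the change of variables the two integrals differ by the factor
  \<open>|J\<^sub>T| (\<omega>2 \<circ> T) / \<omega>1\<close>, which is continuous off the origin and hence bounded on the compact
  closure of \<open>V\<close>.
\<close>
lemma nn_integral_weighted_inversion_le:
  fixes V :: "(real^'n) set"
  assumes V: "off_origin V" and \<omega>: "admissible_weight \<omega>1" "admissible_weight \<omega>2"
  obtains C :: real where "0 \<le> C"
    "\<And>h. h \<in> borel_measurable (lebesgue_on V) \<Longrightarrow>
      (\<integral>\<^sup>+x. h (inversion x) \<partial>weighted_on \<omega>2 (inversion ` V)) \<le> C * (\<integral>\<^sup>+x. h x \<partial>weighted_on \<omega>1 V)"
proof -
  define r where "r x = inversion_jacobian x * \<omega>2 (inversion x) / \<omega>1 x" for x :: "real^'n"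
  have cl: "compact (closure V)" "closure V \<subseteq> - {0}" and "open V" "0 \<notin> V"
    using V closure_subset by (auto simp: off_origin_def compactly_inside_def)
  have Vleb: "V \<in> sets lebesgue"
    using \<open>open V\<close> by (intro sets_completionI_sets) (simp add: borel_open)
  have iV0: "0 \<notin> inversion ` V" using \<open>0 \<notin> V\<close> by (auto dest: sym)
  have iVleb: "inversion ` V \<in> sets lebesgue"
    using open_inversion_image[OF \<open>open V\<close> \<open>0 \<notin> V\<close>]
    by (intro sets_completionI_sets) (simp add: borel_open)
  have "continuous_on (- {0}) (\<lambda>x. \<omega>2 (inversion x))"
    using \<omega>(2)
    by (intro continuous_on_compose2[of "- {0}" \<omega>2 "- {0}" inversion] continuous_on_inversion)
       (auto simp: admissible_weight_def)
  then have "continuous_on (- {0}) r"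
    unfolding r_def inversion_jacobian_def using \<omega>(1)
    by (intro continuous_intros) (auto simp: admissible_weight_def less_imp_neq[symmetric])
  then have "bounded (r ` closure V)"
    using cl by (meson compact_continuous_image compact_imp_bounded continuous_on_subset)
  then obtain C where C: "\<And>x. x \<in> closure V \<Longrightarrow> \<bar>r x\<bar> \<le> C" "0 < C"
    by (auto simp: bounded_pos)
  show thesis
  proof (rule that)
    show "0 \<le> C" using C by simp
    fix h :: "real^'n \<Rightarrow> ennreal" assume h: "h \<in> borel_measurable (lebesgue_on V)"
    note \<omega>1m = measurable_admissible_weight[OF \<omega>(1) Vleb \<open>0 \<notin> V\<close>]
    note \<omega>2m = measurable_admissible_weight[OF \<omega>(2) iVleb iV0]
    (* The change of variables turns the integral of F into the left-hand side. *)
    define F where "F x = ennreal (inversion_jacobian x * \<omega>2 (inversion x)) * h x * indicator V x" for x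
    have "(\<lambda>x. \<omega>2 (inversion x)) \<in> borel_measurable (lebesgue_on V)"
      using measurable_comp_inversion[OF \<omega>2m] by simp
    moreover have "inversion_jacobian \<in> borel_measurable (lebesgue_on V)"
      by (simp add: measurable_completion measurable_restrict_space1)
    ultimately have Fm: "F \<in> borel_measurable lebesgue"
      unfolding F_def using h Vleb by (subst borel_measurable_restrict_space_iff_ennreal[symmetric]) auto
    have "(\<integral>\<^sup>+x. h (inversion x) \<partial>weighted_on \<omega>2 (inversion ` V))
        = (\<integral>\<^sup>+x. ennreal (\<omega>2 x) * h (inversion x) * indicator (inversion ` V) x \<partial>lebesgue)"
      by (rule nn_integral_weighted_on[OF iVleb \<omega>2m measurable_comp_inversion[OF h]])
    also have "\<dots> = (\<integral>\<^sup>+x. ennreal (inversion_jacobian x) * F (inversion x) \<partial>lebesgue)"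
    proof (rule nn_integral_cong)
      fix x :: "real^'n"
      show "ennreal (\<omega>2 x) * h (inversion x) * indicator (inversion ` V) x
          = ennreal (inversion_jacobian x) * F (inversion x)"
      proof (cases "inversion x \<in> V")
        case True
        then have "x \<noteq> 0" using \<open>0 \<notin> V\<close> by auto
        then have "ennreal (inversion_jacobian x) * ennreal (inversion_jacobian (inversion x) * \<omega>2 x) = ennreal (\<omega>2 x)"
          using inversion_jacobian_mult_inversion[of x]
          by (subst ennreal_mult'[symmetric]) (simp_all flip: mult.assoc)
        then show ?thesis
          using True by (simp add: F_def inversion_image_eq_vimage flip: mult.assoc)
      qed (simp add: F_def inversion_image_eq_vimage)
    qed
    also have "\<dots> = (\<integral>\<^sup>+x. F x \<partial>lebesgue)"
      by (rule nn_integral_inversion[OF Fm])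
    also have "\<dots> \<le> (\<integral>\<^sup>+x. ennreal C * (ennreal (\<omega>1 x) * h x * indicator V x) \<partial>lebesgue)"
    proof (rule nn_integral_mono)
      fix x :: "real^'n"
      show "F x \<le> ennreal C * (ennreal (\<omega>1 x) * h x * indicator V x)"
      proof (cases "x \<in> V")
        case True
        then have "x \<noteq> 0" using \<open>0 \<notin> V\<close> by auto
        then have "0 < \<omega>1 x" using \<omega>(1) by (simp add: admissible_weight_def)
        moreover have "r x \<le> C"
          using C(1)[of x] True closure_subset by fastforce
        ultimately have "inversion_jacobian x * \<omega>2 (inversion x) \<le> C * \<omega>1 x"
          by (simp add: r_def divide_le_eq)
        then have "ennreal (inversion_jacobian x * \<omega>2 (inversion x)) \<le> ennreal C * ennreal (\<omega>1 x)"
          using C(2) \<open>0 < \<omega>1 x\<close> by (simp add: ennreal_mult[symmetric] ennreal_leI)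
        then show ?thesis
          using True by (simp add: F_def mult_right_mono flip: mult.assoc)
      qed (simp add: F_def)
    qed
    also have "\<dots> = C * (\<integral>\<^sup>+x. ennreal (\<omega>1 x) * h x * indicator V x \<partial>lebesgue)"
      using \<omega>1m h Vleb
      by (intro nn_integral_cmult) (subst borel_measurable_restrict_space_iff_ennreal[symmetric], auto)
    also have "\<dots> = C * (\<integral>\<^sup>+x. h x \<partial>weighted_on \<omega>1 V)"
      by (simp add: nn_integral_weighted_on[OF Vleb \<omega>1m h])
    finally show "(\<integral>\<^sup>+x. h (inversion x) \<partial>weighted_on \<omega>2 (inversion ` V)) \<le> C * (\<integral>\<^sup>+x. h x \<partial>weighted_on \<omega>1 V)" .
  qed
qed

lemma Lp_iff_nn_integral:
  "Lp p \<omega> V f \<longleftrightarrow> f \<in> borel_measurable (lebesgue_on V) \<and>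
    (\<integral>\<^sup>+x. ennreal (norm (f x) powr p) \<partial>weighted_on \<omega> V) < \<infinity>"
  by (auto simp: Lp_def integrable_iff_bounded)

text \<open>
  A uniformly bounded, measurable family of linear maps of the fibre. Functions and gradients can
  then be treated by the same estimates: the family is the identity for the former and \<open>dT\<close> for
  the latter.
\<close>
definition bounded_bundle_map ::
  "'a::euclidean_space set \<Rightarrow> ('a \<Rightarrow> 'b::euclidean_space \<Rightarrow> 'b) \<Rightarrow> bool"
  where "bounded_bundle_map V L \<longleftrightarrow>
    (\<forall>x. linear (L x)) \<and>
    (\<exists>K. \<forall>x\<in>V. \<forall>v. norm (L x v) \<le> K * norm v) \<and>
    (\<forall>f\<in>borel_measurable (lebesgue_on V). (\<lambda>x. L x (f x)) \<in> borel_measurable (lebesgue_on V))"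

lemma bounded_bundle_map_id: "bounded_bundle_map V (\<lambda>_ v. v)"
  by (auto simp: bounded_bundle_map_def linear_id[unfolded id_def] intro!: exI[of _ 1])

lemma bounded_bundle_map_inversion_deriv:
  assumes "off_origin V"
  shows "bounded_bundle_map (inversion ` V) inversion_deriv"
proof -
  have "bounded V"
    using assms by (meson bounded_closure_image bounded_subset closure_subset compact_imp_bounded compactly_inside_def off_origin_def)
  then obtain B where B: "\<And>x. x \<in> V \<Longrightarrow> norm x \<le> B"
    by (auto simp: bounded_iff)
  have "norm (inversion_deriv x v) \<le> B\<^sup>2 * norm v" if "x \<in> inversion ` V" for x v
  proof -
    have "(norm (inversion x))\<^sup>2 \<le> B\<^sup>2"
      using that B by (intro power_mono) auto
    then have "(norm (inversion x))\<^sup>2 * norm v \<le> B\<^sup>2 * norm v"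
      by (intro mult_right_mono) auto
    then show ?thesis
      by (simp add: norm_inversion_deriv norm_inversion divide_inverse power_inverse mult.commute)
  qed
  moreover have "(\<lambda>x. inversion_deriv x (f x)) \<in> borel_measurable (lebesgue_on (inversion ` V))"
    if [measurable]: "f \<in> borel_measurable (lebesgue_on (inversion ` V))" for f
  proof -
    have [measurable]: "(\<lambda>x. x) \<in> borel_measurable (lebesgue_on (inversion ` V))"
      using id_borel_measurable_lebesgue_on unfolding id_def .
    show ?thesis
      unfolding inversion_deriv_def by measurable
  qed
  ultimately show ?thesis
    unfolding bounded_bundle_map_def using linear_inversion_deriv by blast
qed

text \<open>
  The constant is the same for all \<open>f\<close>: applied to differences \<open>\<phi>\<^sub>j - f\<close> the estimate therefore
  preserves convergence.
\<close>
lemma nn_integral_bundle_map_inversion_le: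
  fixes V :: "(real^'n) set" and L :: "real^'n \<Rightarrow> 'b::euclidean_space \<Rightarrow> 'b"
  assumes "off_origin V" "admissible_weight \<omega>1" "admissible_weight \<omega>2" "0 \<le> p"
    and L: "bounded_bundle_map (inversion ` V) L"
  obtains C :: real where
    "\<And>f. f \<in> borel_measurable (lebesgue_on V) \<Longrightarrow>
      (\<integral>\<^sup>+x. ennreal (norm (L x (f (inversion x))) powr p) \<partial>weighted_on \<omega>2 (inversion ` V))
        \<le> C * (\<integral>\<^sup>+x. ennreal (norm (f x) powr p) \<partial>weighted_on \<omega>1 V)"
proof -
  obtain C :: real where C: "0 \<le> C"
    "\<And>h. h \<in> borel_measurable (lebesgue_on V) \<Longrightarrow>
      (\<integral>\<^sup>+x. h (inversion x) \<partial>weighted_on \<omega>2 (inversion ` V)) \<le> C * (\<integral>\<^sup>+x. h x \<partial>weighted_on \<omega>1 V)"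
    by (rule nn_integral_weighted_inversion_le[OF assms(1-3)]) blast
  obtain K where K: "\<And>x v. x \<in> inversion ` V \<Longrightarrow> norm (L x v) \<le> K * norm v"
    using L unfolding bounded_bundle_map_def by blast
  show thesis
  proof (rule that)
    fix f :: "real^'n \<Rightarrow> 'b" assume [measurable]: "f \<in> borel_measurable (lebesgue_on V)"
    define h where "h x = ennreal (\<bar>K\<bar> powr p) * ennreal (norm (f x) powr p)" for x
    have hm: "h \<in> borel_measurable (lebesgue_on V)"
      unfolding h_def by measurable
    have "(\<integral>\<^sup>+x. ennreal (norm (L x (f (inversion x))) powr p) \<partial>weighted_on \<omega>2 (inversion ` V))
        \<le> (\<integral>\<^sup>+x. h (inversion x) \<partial>weighted_on \<omega>2 (inversion ` V))"
    proof (rule nn_integral_mono)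
      fix x assume "x \<in> space (weighted_on \<omega>2 (inversion ` V))"
      then have "norm (L x (f (inversion x))) \<le> K * norm (f (inversion x))"
        using K by simp
      also have "\<dots> \<le> \<bar>K\<bar> * norm (f (inversion x))"
        by (intro mult_right_mono) auto
      finally have "norm (L x (f (inversion x))) powr p \<le> (\<bar>K\<bar> * norm (f (inversion x))) powr p"
        using \<open>0 \<le> p\<close> by (intro powr_mono2) auto
      then show "ennreal (norm (L x (f (inversion x))) powr p) \<le> h (inversion x)"
        by (simp add: h_def powr_mult ennreal_leI flip: ennreal_mult)
    qed
    also have "\<dots> \<le> C * (\<integral>\<^sup>+x. h x \<partial>weighted_on \<omega>1 V)"
      by (rule C(2)[OF hm])
    also have "(\<integral>\<^sup>+x. h x \<partial>weighted_on \<omega>1 V)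
        = ennreal (\<bar>K\<bar> powr p) * (\<integral>\<^sup>+x. ennreal (norm (f x) powr p) \<partial>weighted_on \<omega>1 V)"
      unfolding h_def by (rule nn_integral_cmult) simp
    finally show "(\<integral>\<^sup>+x. ennreal (norm (L x (f (inversion x))) powr p) \<partial>weighted_on \<omega>2 (inversion ` V))
        \<le> ennreal (C * \<bar>K\<bar> powr p) * (\<integral>\<^sup>+x. ennreal (norm (f x) powr p) \<partial>weighted_on \<omega>1 V)"
      using C(1) by (simp add: ennreal_mult mult.assoc)
  qed
qed

lemma Lp_bundle_map_inversion:
  assumes hyps: "off_origin V" "admissible_weight \<omega>1" "admissible_weight \<omega>2" "0 \<le> p"
      "bounded_bundle_map (inversion ` V) L"
    and f: "Lp p \<omega>1 V f"
  shows "Lp p \<omega>2 (inversion ` V) (\<lambda>x. L x (f (inversion x)))"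
proof -
  have m: "f \<in> borel_measurable (lebesgue_on V)" and fin: "(\<integral>\<^sup>+x. ennreal (norm (f x) powr p) \<partial>weighted_on \<omega>1 V) < \<infinity>"
    using f by (auto simp: Lp_iff_nn_integral)
  obtain C :: real where C: "\<And>g. g \<in> borel_measurable (lebesgue_on V) \<Longrightarrow>
    (\<integral>\<^sup>+x. ennreal (norm (L x (g (inversion x))) powr p) \<partial>weighted_on \<omega>2 (inversion ` V))
        \<le> C * (\<integral>\<^sup>+x. ennreal (norm (g x) powr p) \<partial>weighted_on \<omega>1 V)"
    by (rule nn_integral_bundle_map_inversion_le[OF hyps]) blast
  have "(\<integral>\<^sup>+x. ennreal (norm (L x (f (inversion x))) powr p) \<partial>weighted_on \<omega>2 (inversion ` V))
      \<le> C * (\<integral>\<^sup>+x. ennreal (norm (f x) powr p) \<partial>weighted_on \<omega>1 V)"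
    by (rule C[OF m])
  also have "\<dots> < \<infinity>"
    using fin by (simp add: ennreal_mult_less_top)
  finally show ?thesis
    using hyps(5) measurable_comp_inversion[OF m] by (simp add: Lp_iff_nn_integral bounded_bundle_map_def)
qed

lemma Lp_converges_bundle_map_inversion:
  assumes hyps: "off_origin V" "admissible_weight \<omega>1" "admissible_weight \<omega>2" "0 \<le> p"
      "bounded_bundle_map (inversion ` V) L"
    and conv: "Lp_converges p \<omega>1 V \<phi> f"
  shows "Lp_converges p \<omega>2 (inversion ` V) (\<lambda>j x. L x (\<phi> j (inversion x))) (\<lambda>x. L x (f (inversion x)))"
proof -
  let ?I = "\<lambda>j. \<integral>\<^sup>+x. ennreal (norm (\<phi> j x - f x) powr p) \<partial>weighted_on \<omega>1 V"
  let ?J = "\<lambda>j. \<integral>\<^sup>+x. ennreal (norm (L x (\<phi> j (inversion x)) - L x (f (inversion x))) powr p) \<partial>weighted_on \<omega>2 (inversion ` V)"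
  have Lp: "\<And>j. Lp p \<omega>1 V (\<phi> j)" "Lp p \<omega>1 V f" and lim: "?I \<longlonglongrightarrow> 0"
    using conv by (auto simp: Lp_converges_def)
  obtain C :: real where C: "\<And>g. g \<in> borel_measurable (lebesgue_on V) \<Longrightarrow>
    (\<integral>\<^sup>+x. ennreal (norm (L x (g (inversion x))) powr p) \<partial>weighted_on \<omega>2 (inversion ` V))
        \<le> C * (\<integral>\<^sup>+x. ennreal (norm (g x) powr p) \<partial>weighted_on \<omega>1 V)"
    by (rule nn_integral_bundle_map_inversion_le[OF hyps]) blast
  have "?J j \<le> C * ?I j" for j
  proof -
    have "(\<lambda>x. \<phi> j x - f x) \<in> borel_measurable (lebesgue_on V)"
      using Lp by (intro borel_measurable_diff) (auto simp: Lp_iff_nn_integral)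
    then show ?thesis
      using C[of "\<lambda>x. \<phi> j x - f x"] hyps(5) by (simp add: bounded_bundle_map_def linear_diff)
  qed
  moreover have "(\<lambda>j. C * ?I j) \<longlonglongrightarrow> 0"
    using ennreal_tendsto_cmult[OF _ lim, of "ennreal C"] by simp
  ultimately have "?J \<longlonglongrightarrow> 0"
    by (intro tendsto_sandwich[where f = "\<lambda>_. 0" and h = "\<lambda>j. C * ?I j" and g = ?J]) auto
  then show ?thesis
    using Lp Lp_bundle_map_inversion[OF hyps] by (simp add: Lp_converges_def)
qed

lemma Lp_cong: "(\<And>x. x \<in> V \<Longrightarrow> f x = g x) \<Longrightarrow> Lp p \<omega> V f \<longleftrightarrow> Lp p \<omega> V g"
  unfolding Lp_iff_nn_integral
  by (intro conj_cong arg_cong2[where f = "(<)"] measurable_cong nn_integral_cong) auto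

lemma Lp_converges_cong:
  assumes "\<And>j x. x \<in> V \<Longrightarrow> \<phi> j x = \<psi> j x" and "\<And>x. x \<in> V \<Longrightarrow> f x = g x"
  shows "Lp_converges p \<omega> V \<phi> f \<longleftrightarrow> Lp_converges p \<omega> V \<psi> g"
proof -
  have "(\<integral>\<^sup>+x. ennreal (norm (\<phi> j x - f x) powr p) \<partial>weighted_on \<omega> V)
      = (\<integral>\<^sup>+x. ennreal (norm (\<psi> j x - g x) powr p) \<partial>weighted_on \<omega> V)" for j
    using assms by (intro nn_integral_cong) simp
  then show ?thesis
    using Lp_cong[of V "\<phi> _" "\<psi> _"] Lp_cong[of V f g] assms by (simp add: Lp_converges_def)
qed

lemma smooth_on_imp_differentiable: "smooth_on V f \<Longrightarrow> x \<in> V \<Longrightarrow> f differentiable (at x)"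
  unfolding smooth_on_def by (metis Ck_on.simps(2))

text \<open>
  If smooth \<open>\<phi>\<^sub>j\<close> approximate \<open>u\<close> with gradients approximating \<open>v\<close>, then \<open>\<phi>\<^sub>j \<circ> T\<close> approximate
  \<open>u \<circ> T\<close>, and by the chain rule their gradients are the images of those of \<open>\<phi>\<^sub>j\<close> under the bounded
  family \<open>dT\<close>.
\<close>
lemma has_H1p_gradient_inversion:
  assumes hyps: "off_origin V" "admissible_weight \<omega>1" "admissible_weight \<omega>2" "0 \<le> p"
    and grad: "has_H1p_gradient p \<omega>1 V u v"
  shows "has_H1p_gradient p \<omega>2 (inversion ` V) (u \<circ> inversion) (\<lambda>x. inversion_deriv x (v (inversion x)))"
proof -
  have "open V" "0 \<notin> V"
    using hyps(1) closure_subset by (auto simp: off_origin_def compactly_inside_def)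
  note D = bounded_bundle_map_inversion_deriv[OF hyps(1)]
  obtain \<phi> where smooth: "\<And>j. smooth_on V (\<phi> j)"
    and \<phi>: "Lp_converges p \<omega>1 V \<phi> u" "Lp_converges p \<omega>1 V (\<lambda>j. grad (\<phi> j)) v"
    using grad by (auto simp: has_H1p_gradient_def)
  have smooth': "smooth_on (inversion ` V) (\<phi> j \<circ> inversion)" for j
    using smooth \<open>open V\<close> \<open>0 \<notin> V\<close> by (rule smooth_on_comp_inversion)
  have conv: "Lp_converges p \<omega>2 (inversion ` V) (\<lambda>j. \<phi> j \<circ> inversion) (u \<circ> inversion)"
    using Lp_converges_bundle_map_inversion[OF hyps bounded_bundle_map_id \<phi>(1)] by (simp add: comp_def)
  have conv': "Lp_converges p \<omega>2 (inversion ` V) (\<lambda>j. grad (\<phi> j \<circ> inversion))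
      (\<lambda>x. inversion_deriv x (v (inversion x)))"
  proof (subst Lp_converges_cong)
    show "Lp_converges p \<omega>2 (inversion ` V) (\<lambda>j x. inversion_deriv x (grad (\<phi> j) (inversion x)))
        (\<lambda>x. inversion_deriv x (v (inversion x)))"
      by (rule Lp_converges_bundle_map_inversion[OF hyps D \<phi>(2)])
    fix j x assume "x \<in> inversion ` V"
    then show "grad (\<phi> j \<circ> inversion) x = inversion_deriv x (grad (\<phi> j) (inversion x))"
      using smooth \<open>0 \<notin> V\<close> by (intro grad_comp_inversion smooth_on_imp_differentiable) auto
  qed simp
  have "Lp p \<omega>2 (inversion ` V) (u \<circ> inversion)"
      "Lp p \<omega>2 (inversion ` V) (\<lambda>x. inversion_deriv x (v (inversion x)))"
    using conv conv' by (simp_all add: Lp_converges_def)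
  with smooth' conv conv' show ?thesis
    unfolding has_H1p_gradient_def by (intro conjI exI[of _ "\<lambda>j. \<phi> j \<circ> inversion"] allI)
qed

lemma has_H1p_loc_gradient_inversion:
  assumes "0 \<notin> V" "admissible_weight \<omega>1" "admissible_weight \<omega>2" "0 \<le> p"
    and "has_H1p_loc_gradient p \<omega>1 V u v"
  shows "has_H1p_loc_gradient p \<omega>2 (inversion ` V) (u \<circ> inversion) (\<lambda>x. inversion_deriv x (v (inversion x)))"
  unfolding has_H1p_loc_gradient_def
proof (intro allI impI)
  fix G assume "open G" "compactly_inside G (inversion ` V)"
  note G = inner_regions_inversion[OF assms(1) this]
  have "has_H1p_gradient p \<omega>1 (inversion ` G) u v"
    using assms(5) G(2,3) by (simp add: has_H1p_loc_gradient_def)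
  from has_H1p_gradient_inversion[OF G(1) assms(2-4) this]
  show "has_H1p_gradient p \<omega>2 G (u \<circ> inversion) (\<lambda>x. inversion_deriv x (v (inversion x)))"
    by simp
qed

lemma has_H1p_loc_gradient_imp_H1p_loc: "has_H1p_loc_gradient p \<omega> V u v \<Longrightarrow> H1p_loc p \<omega> V u"
  by (auto simp: H1p_loc_def H1p_def Lp_loc_def has_H1p_loc_gradient_def has_H1p_gradient_def)

section \<open>Harmonic functions under the inversion\<close>

lemma jacobian_inversion:
  fixes x :: "real^'n"
  assumes "x \<noteq> 0"
  shows "jacobian inversion (at x) *v h = inversion_deriv x h"
    and "\<bar>det (jacobian inversion (at x))\<bar> = inversion_jacobian x"
proof -
  have "frechet_derivative inversion (at x) = inversion_deriv x"
    using has_derivative_inversion[OF assms] frechet_derivative_at by metis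
  then have J: "jacobian inversion (at x) = matrix (inversion_deriv x)"
    by (simp add: jacobian_def)
  show "jacobian inversion (at x) *v h = inversion_deriv x h"
    by (simp add: J matrix_works linear_inversion_deriv)
  show "\<bar>det (jacobian inversion (at x))\<bar> = inversion_jacobian x"
    by (simp add: J abs_det_inversion_deriv[OF assms])
qed

lemma transformed_map_eq:
  assumes "\<xi> \<noteq> 0"
  shows "transformed_map A \<xi> q =
    inversion_jacobian \<xi> *\<^sub>R inversion_deriv (inversion \<xi>) (A (inversion \<xi>) (inversion_deriv (inversion \<xi>) q))"
  using assms
  by (simp add: transformed_map_def Let_def jacobian_inversion inversion_jacobian_inversion)

text \<open>
  The two Jacobian factors cancel, and so do \<open>dT(x)\<close> and \<open>dT(Tx)\<close> on both sides of \<open>A\<close>. The origin is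
  excluded because the transformed map is set to \<open>0\<close> there.
\<close>
lemma transformed_map_involution:
  assumes "x \<noteq> 0"
  shows "transformed_map (transformed_map A) x q = A x q"
proof -
  have *: "inversion_deriv x (inversion_deriv (inversion x) h) = h" for h
    using inversion_deriv_inversion[of "inversion x" h] assms by simp
  show ?thesis
    using assms inversion_jacobian_mult_inversion[of x]
    by (simp add: transformed_map_eq * inversion_deriv_inversion linear_cmul[OF linear_inversion_deriv])
qed

text \<open>
  With the transformed gradient \<open>dT(x) v(Tx)\<close>, the inner differential in the transformed map
  is undone; the outer one moves to \<open>\<nabla>\<phi>\<close> by selfadjointness and is undone there. What remains is
  \<open>|J\<^sub>T|\<close> times the original integrand composed with \<open>T\<close>.
\<close>
lemma harmonic_in_inversion:
  fixes V :: "(real^'n) set"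
  assumes V: "open V" "0 \<notin> V" and \<omega>: "admissible_weight \<omega>1" "admissible_weight \<omega>2" and p: "0 \<le> p"
    and harm: "harmonic_in p A \<omega>1 V u"
  shows "harmonic_in p (transformed_map A) \<omega>2 (inversion ` V) (u \<circ> inversion)"
proof -
  obtain v where v: "has_H1p_loc_gradient p \<omega>1 V u v"
    and weak: "\<And>\<phi>. test_function V \<phi> \<Longrightarrow> (LINT x:V|lebesgue. A x (v x) \<bullet> grad \<phi> x) = 0"
    using harm by (auto simp: harmonic_in_def)
  define v' where "v' x = inversion_deriv x (v (inversion x))" for x
  have v': "has_H1p_loc_gradient p \<omega>2 (inversion ` V) (u \<circ> inversion) v'"
    unfolding v'_def by (rule has_H1p_loc_gradient_inversion[OF V(2) \<omega> p v])
  have iV0: "0 \<notin> inversion ` V"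
    using V(2) by (rule zero_notin_inversion_image)
  have iVleb: "inversion ` V \<in> sets lebesgue"
    using open_inversion_image[OF V] by (intro sets_completionI_sets) (simp add: borel_open)
  have "(LINT x:inversion ` V|lebesgue. transformed_map A x (v' x) \<bullet> grad \<phi> x) = 0"
    if \<phi>: "test_function (inversion ` V) \<phi>" for \<phi>
  proof -
    define \<psi> where "\<psi> = \<phi> \<circ> inversion"
    have \<psi>: "test_function V \<psi>"
      using test_function_inversion[OF \<phi> iV0] by (simp add: \<psi>_def)
    have \<phi>_eq: "\<phi> = \<psi> \<circ> inversion"
      by (simp add: \<psi>_def comp_assoc)
    have "transformed_map A x (v' x) \<bullet> grad \<phi> x
        = inversion_jacobian x * (A (inversion x) (v (inversion x)) \<bullet> grad \<psi> (inversion x))"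
      if "x \<in> inversion ` V" for x
    proof -
      have "x \<noteq> 0" using that iV0 by auto
      have "\<psi> differentiable (at (inversion x))"
        using \<psi> by (auto simp: test_function_def intro: smooth_on_imp_differentiable)
      then have "grad \<phi> x = inversion_deriv x (grad \<psi> (inversion x))"
        unfolding \<phi>_eq using \<open>x \<noteq> 0\<close> by (rule grad_comp_inversion)
      then show ?thesis
        using \<open>x \<noteq> 0\<close>
        by (simp add: transformed_map_eq v'_def inversion_deriv_inversion inversion_deriv_selfadjoint)
    qed
    then have "(LINT x:inversion ` V|lebesgue. transformed_map A x (v' x) \<bullet> grad \<phi> x)
        = (LINT x:inversion ` V|lebesgue.
            inversion_jacobian x * (A (inversion x) (v (inversion x)) \<bullet> grad \<psi> (inversion x)))"
      using iVleb by (intro set_lebesgue_integral_cong) auto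
    also have "\<dots> = (LINT x:V|lebesgue. A x (v x) \<bullet> grad \<psi> x)"
      by (rule integral_inversion_set[OF V(2), of "\<lambda>x. A x (v x) \<bullet> grad \<psi> x"])
    also have "\<dots> = 0"
      by (rule weak[OF \<psi>])
    finally show ?thesis .
  qed
  moreover have "continuous_on (inversion ` V) (u \<circ> inversion)"
    using harm iV0 by (intro continuous_on_compose continuous_on_inversion) (simp_all add: harmonic_in_def)
  ultimately show ?thesis
    unfolding harmonic_in_def using v' has_H1p_loc_gradient_imp_H1p_loc[OF v'] by blast
qed

lemma harmonic_in_cong_map:
  assumes "open V" and "\<And>x q. x \<in> V \<Longrightarrow> A x q = B x q"
  shows "harmonic_in p A \<omega> V u \<longleftrightarrow> harmonic_in p B \<omega> V u"
proof -
  have "V \<in> sets lebesgue"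
    using assms(1) by (intro sets_completionI_sets) (simp add: borel_open)
  then have "(LINT x:V|lebesgue. A x (v x) \<bullet> grad \<phi> x) = (LINT x:V|lebesgue. B x (v x) \<bullet> grad \<phi> x)" for v \<phi>
    using assms(2) by (intro set_lebesgue_integral_cong) auto
  then show ?thesis
    by (simp add: harmonic_in_def)
qed

lemma harmonic_in_transformed_map_involution:
  assumes "open V" "0 \<notin> V"
  shows "harmonic_in p (transformed_map (transformed_map A)) \<omega> V u \<longleftrightarrow> harmonic_in p A \<omega> V u"
  using assms by (intro harmonic_in_cong_map transformed_map_involution) auto

text \<open>
  The converse is the implication just proved, applied to the transformed map on \<open>T(V)\<close> with the
  weights interchanged.
\<close>
lemma harmonic_in_inversion_iff:
  fixes V :: "(real^'n) set"
  assumes V: "open V" "0 \<notin> V" and \<omega>: "admissible_weight \<omega>1" "admissible_weight \<omega>2" and p: "0 \<le> p"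
  shows "harmonic_in p A \<omega>1 V u \<longleftrightarrow>
    harmonic_in p (transformed_map A) \<omega>2 (inversion ` V) (u \<circ> inversion)"
proof
  assume "harmonic_in p (transformed_map A) \<omega>2 (inversion ` V) (u \<circ> inversion)"
  from harmonic_in_inversion[OF open_inversion_image[OF V] zero_notin_inversion_image[OF V(2)] \<omega>(2,1) p this]
  show "harmonic_in p A \<omega>1 V u"
    by (simp add: comp_assoc harmonic_in_transformed_map_involution[OF V])
qed (rule harmonic_in_inversion[OF V \<omega> p])

section \<open>Superharmonic functions under the inversion\<close>

lemma lower_semicontinuous_on_inversion:
  assumes "open V" "0 \<notin> V" "lower_semicontinuous_on V u"
  shows "lower_semicontinuous_on (inversion ` V) (u \<circ> inversion)"
  unfolding lower_semicontinuous_on_def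
proof
  fix t
  have "open {x\<in>V. t < u x}"
    using assms by (simp add: lower_semicontinuous_on_def openin_open_eq)
  then have "open (inversion ` {x\<in>V. t < u x})"
    using assms(2) by (intro open_inversion_image) auto
  moreover have "{x \<in> inversion ` V. t < (u \<circ> inversion) x} = inversion ` {x\<in>V. t < u x}"
    by auto
  ultimately show "openin (top_of_set (inversion ` V)) {x \<in> inversion ` V. t < (u \<circ> inversion) x}"
    using open_inversion_image[OF assms(1,2)] by (simp add: openin_open_eq) blast
qed

lemma components_inversion:
  assumes "0 \<notin> V" and K: "K \<in> components (inversion ` V)"
  shows "inversion ` K \<in> components V"
proof -
  have hom: "homeomorphism (inversion ` V) V inversion inversion"
    using assms(1) zero_notin_inversion_image[OF assms(1)]
    by (intro homeomorphismI continuous_on_inversion) auto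
  obtain x where x: "x \<in> inversion ` V" "K = connected_component_set (inversion ` V) x"
    using K by (auto simp: components_def)
  then have "inversion ` K = connected_component_set V (inversion x)"
    using connected_component_set_homeomorphism[OF hom x(1)] by simp
  then show ?thesis
    using x(1) by (auto simp: components_def)
qed

text \<open>
  A comparison function \<open>v\<close> on \<open>G\<close> inside \<open>T(V)\<close> gives the comparison function \<open>v \<circ> T\<close> on \<open>T(G)\<close>
  inside \<open>V\<close>: it is harmonic for the twice transformed map, which is \<open>A\<close> off the origin.
\<close>
lemma superharmonic_in_inversion:
  fixes V :: "(real^'n) set"
  assumes V: "open V" "0 \<notin> V" and \<omega>: "admissible_weight \<omega>1" "admissible_weight \<omega>2" and p: "0 \<le> p"
    and super: "superharmonic_in p A \<omega>1 V u"
  shows "superharmonic_in p (transformed_map A) \<omega>2 (inversion ` V) (u \<circ> inversion)"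
  unfolding superharmonic_in_def
proof (intro conjI ballI allI impI)
  show "(u \<circ> inversion) x \<noteq> - \<infinity>" if "x \<in> inversion ` V" for x
    using that super by (auto simp: superharmonic_in_def)
  show "lower_semicontinuous_on (inversion ` V) (u \<circ> inversion)"
    using V super by (intro lower_semicontinuous_on_inversion) (auto simp: superharmonic_in_def)
  show "\<exists>x\<in>K. (u \<circ> inversion) x \<noteq> \<infinity>" if "K \<in> components (inversion ` V)" for K
    using components_inversion[OF V(2) that] super unfolding superharmonic_in_def by fastforce
  fix G v \<xi>
  assume G: "open G" "compactly_inside G (inversion ` V)" and cont: "continuous_on (closure G) v"
    and harm: "harmonic_in p (transformed_map A) \<omega>2 G v"
    and le: "\<forall>x\<in>frontier G. ereal (v x) \<le> (u \<circ> inversion) x" and \<xi>: "\<xi> \<in> G"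
  note G' = inner_regions_inversion[OF V(2) G]
  have "off_origin G"
    using off_origin_if_compactly_inside[OF G zero_notin_inversion_image[OF V(2)]] .
  then have G0: "0 \<notin> closure G" "0 \<notin> G" and inside: "compactly_inside G (- {0})"
    using closure_subset by (auto simp: off_origin_def compactly_inside_def)
  have "harmonic_in p (transformed_map (transformed_map A)) \<omega>1 (inversion ` G) (v \<circ> inversion)"
    by (rule harmonic_in_inversion[OF G(1) G0(2) \<omega>(2,1) p harm])
  then have "harmonic_in p A \<omega>1 (inversion ` G) (v \<circ> inversion)"
    using harmonic_in_transformed_map_involution[OF G'(2) zero_notin_inversion_image[OF G0(2)]] by blast
  moreover have "continuous_on (closure (inversion ` G)) (v \<circ> inversion)"
    unfolding closure_inversion_image[OF inside] using cont zero_notin_inversion_image[OF G0(1)]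
    by (intro continuous_on_compose continuous_on_inversion) auto
  moreover have "\<forall>x\<in>frontier (inversion ` G). ereal ((v \<circ> inversion) x) \<le> u x"
    unfolding frontier_inversion_image[OF \<open>off_origin G\<close>] using le by simp
  ultimately have "\<forall>x\<in>inversion ` G. ereal ((v \<circ> inversion) x) \<le> u x"
    using super G'(2,3) unfolding superharmonic_in_def by blast
  then show "ereal (v \<xi>) \<le> (u \<circ> inversion) \<xi>"
    using \<xi> by auto
qed

lemma superharmonic_in_cong_map:
  assumes "\<And>x q. x \<in> V \<Longrightarrow> A x q = B x q"
  shows "superharmonic_in p A \<omega> V u \<longleftrightarrow> superharmonic_in p B \<omega> V u"
proof -
  have "harmonic_in p A \<omega> G v \<longleftrightarrow> harmonic_in p B \<omega> G v" if "open G" "compactly_inside G V" for G v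
  proof -
    have "G \<subseteq> V"
      using that(2) closure_subset by (auto simp: compactly_inside_def)
    then show ?thesis
      using assms by (intro harmonic_in_cong_map[OF that(1)]) auto
  qed
  then show ?thesis
    unfolding superharmonic_in_def by blast
qed

lemma superharmonic_in_inversion_iff:
  fixes V :: "(real^'n) set"
  assumes V: "open V" "0 \<notin> V" and \<omega>: "admissible_weight \<omega>1" "admissible_weight \<omega>2" and p: "0 \<le> p"
  shows "superharmonic_in p A \<omega>1 V u \<longleftrightarrow>
    superharmonic_in p (transformed_map A) \<omega>2 (inversion ` V) (u \<circ> inversion)"
proof
  assume "superharmonic_in p (transformed_map A) \<omega>2 (inversion ` V) (u \<circ> inversion)"
  from superharmonic_in_inversion[OF open_inversion_image[OF V] zero_notin_inversion_image[OF V(2)] \<omega>(2,1) p this]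
  have "superharmonic_in p (transformed_map (transformed_map A)) \<omega>1 V u"
    by (simp add: comp_assoc)
  moreover have "transformed_map (transformed_map A) x q = A x q" if "x \<in> V" for x q
    using that V(2) by (intro transformed_map_involution) auto
  ultimately show "superharmonic_in p A \<omega>1 V u"
    using superharmonic_in_cong_map by blast
qed (rule superharmonic_in_inversion[OF V \<omega> p])

lemma admissible_weight_1: "admissible_weight (\<lambda>_. 1)"
  by (simp add: admissible_weight_def)

lemma admissible_inversion_weight: "admissible_weight (inversion_weight p)"
  unfolding admissible_weight_def inversion_weight_def by (auto intro!: continuous_intros)

theorem lemma4p6:
  fixes A :: "real^'n \<Rightarrow> real^'n \<Rightarrow> real^'n" and \<Omega> :: "(real^'n) set" and p :: real
  assumes "2 \<le> CARD('n)" and "real CARD('n) \<le> p"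
    and "cond_A1 A" and "cond_A2 A" and "cond_A3 p (\<lambda>_. 1) A"
    and "open \<Omega>" and "\<not> bounded \<Omega>" and "0 \<notin> \<Omega>"
  shows "(\<forall>u :: real^'n \<Rightarrow> real.
            harmonic_in p A (\<lambda>_. 1) \<Omega> u \<longleftrightarrow>
            harmonic_in p (transformed_map A) (inversion_weight p) (inversion ` \<Omega>) (u \<circ> inversion)) \<and>
         (\<forall>u :: real^'n \<Rightarrow> ereal.
            superharmonic_in p A (\<lambda>_. 1) \<Omega> u \<longleftrightarrow>
            superharmonic_in p (transformed_map A) (inversion_weight p) (inversion ` \<Omega>) (u \<circ> inversion))"
proof -
  have "0 \<le> p" using \<open>real CARD('n) \<le> p\<close> by linarith
  then show ?thesis
    using assms(6,8) by (intro conjI allI harmonic_in_inversion_iff superharmonic_in_inversion_iff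
        admissible_weight_1 admissible_inversion_weight)
qed

end
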